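(* Let $m>0$ and let $\Gamma\subset\mathbb Z^2$ be a simply connected lattice region whose boundary is $\partial\Gamma=\alpha\cup\eta_+\cup\eta_-\cup\beta$, where $\alpha\subset\{x=0\}$ and $\beta\subset\{x=m\}$ are vertical intervals, and $\eta_+$ (upper boundary, joining the top endpoints of $\alpha$ and $\beta$) and $\eta_-$ (lower boundary, joining the bottom endpoints of $\alpha$ and $\beta$) are $x$-monotone lattice paths. Assume $O=(0,0)\in\alpha$. Let $\pi_\pm(i,j),\omega_\pm(i,j)\ge 0$ for $(i,j)\in\Gamma$ with $\pi_+(i,j)+\pi_-(i,j)+\omega_+(i,j)+\omega_-(i,j)=1$, and assume they are $y$-invariant: $\pi_\pm(i,j)=\pi_\pm(i,j')$ and $\omega_\pm(i,j)=\omega_\pm(i,j')$ for all $i,j,j'$. Let $\{X_t\}$ be the random walk started at $X_0=O$ with transition probabilities $\mathbf P[(i,j)\to(i\pm1,j)]=\pi_\pm(i,j)$ and $\mathbf P[(i,j)\to(i,j\pm1)]=\omega_\pm(i,j)$, which is absorbed (killed) whenever it tries to step outside $\Gamma$. Let $T$ be the first time $t$ with $X_t\in\beta$ and let $p(k)$ be the probability that $X_T=(m,k)$. Then $$p(k)^2\ \ge\ p(k+1)\,p(k-1)$$ for all $k\in\mathbb Z$ such that $(m,k+1)\in\beta$ and $(m,k-1)\in\beta$.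
   Context: A lattice path is a sequence of points of $\mathbb Z^2$ in which consecutive points are at distance $1$. An $x$-monotone lattice path is one along which the $x$-coordinate is weakly increasing. The region $\Gamma$ consists of the lattice points on and inside $\partial\Gamma$.
   Formalization: It is additionally assumed that β is the whole right side of Γ, i.e. Γ meets the line x=m only in β; if η₊ or η₋ may run along x=m beyond β, the walk can enter β from above or below along that line and the inequality can fail. *)

theory Defs
  imports "HOL-Probability.Probability"
begin

definition plane_pt :: "int \<times> int \<Rightarrow> real \<times> real" where
  "plane_pt p = (real_of_int (fst p), real_of_int (snd p))"

definition lattice_path :: "(int \<times> int) list \<Rightarrow> bool" where
  "lattice_path ps \<longleftrightarrow>
     ps \<noteq> [] \<and> successively (\<lambda>p q. dist (plane_pt p) (plane_pt q) = 1) ps"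

definition x_monotone_path :: "(int \<times> int) list \<Rightarrow> bool" where
  "x_monotone_path ps \<longleftrightarrow> lattice_path ps \<and> sorted (map fst ps)"

definition path_trace :: "(int \<times> int) list \<Rightarrow> (real \<times> real) set" where
  "path_trace ps = plane_pt ` set ps \<union>
     (\<Union>t\<in>{t. Suc t < length ps}. closed_segment (plane_pt (ps ! t)) (plane_pt (ps ! Suc t)))"

definition vertical_interval :: "int \<Rightarrow> int \<Rightarrow> int \<Rightarrow> (int \<times> int) set" where
  "vertical_interval i a b = {i} \<times> {a..b}"

text \<open>The boundary curve in the plane: the left side from \<open>(0, a0)\<close> to \<open>(0, a1)\<close>, the right
  side from \<open>(m, b0)\<close> to \<open>(m, b1)\<close>, and the two lattice paths.\<close>

definition boundary_curve ::
  "int \<Rightarrow> int \<Rightarrow> int \<Rightarrow> int \<Rightarrow> int \<Rightarrow> (int \<times> int) list \<Rightarrow> (int \<times> int) list \<Rightarrow> (real \<times> real) set" where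
  "boundary_curve m a0 a1 b0 b1 etap etam =
     closed_segment (plane_pt (0, a0)) (plane_pt (0, a1)) \<union> path_trace etap \<union>
     path_trace etam \<union> closed_segment (plane_pt (m, b0)) (plane_pt (m, b1))"

text \<open>The abscissa is non-integral so as to compare the horizontal steps of the two paths only: on
  a vertical line through lattice points, non-crossing paths may run along each other.\<close>

definition weakly_above :: "(int \<times> int) list \<Rightarrow> (int \<times> int) list \<Rightarrow> bool" where
  "weakly_above ps qs \<longleftrightarrow>
     (\<forall>x y y'. x \<notin> \<int> \<and> (x, y) \<in> path_trace ps \<and> (x, y') \<in> path_trace qs \<longrightarrow> y' \<le> y)"

definition enclosed_region :: "(real \<times> real) set \<Rightarrow> (int \<times> int) set" where
  "enclosed_region C = {p. plane_pt p \<in> C \<union> inside C}"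

definition step_prob ::
  "(int \<times> int \<Rightarrow> real) \<Rightarrow> (int \<times> int \<Rightarrow> real) \<Rightarrow> (int \<times> int \<Rightarrow> real) \<Rightarrow> (int \<times> int \<Rightarrow> real) \<Rightarrow>
   int \<times> int \<Rightarrow> int \<times> int \<Rightarrow> real" where
  "step_prob pip pim omp omm p q =
     (if q = (fst p + 1, snd p) then pip p
      else if q = (fst p - 1, snd p) then pim p
      else if q = (fst p, snd p + 1) then omp p
      else if q = (fst p, snd p - 1) then omm p
      else 0)"

definition neighbours :: "int \<times> int \<Rightarrow> (int \<times> int) set" where
  "neighbours p = {(fst p + 1, snd p), (fst p - 1, snd p), (fst p, snd p + 1), (fst p, snd p - 1)}"

text \<open>\<open>None\<close> is the state of the walk after it has been killed.\<close>

fun killed_kernel ::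
  "(int \<times> int) set \<Rightarrow> (int \<times> int \<Rightarrow> int \<times> int \<Rightarrow> real) \<Rightarrow>
   (int \<times> int) option \<Rightarrow> (int \<times> int) option \<Rightarrow> real" where
  "killed_kernel G K (Some p) (Some q) = (if q \<in> G then K p q else 0)"
| "killed_kernel G K (Some p) None = (\<Sum>q\<in>neighbours p - G. K p q)"
| "killed_kernel G K None None = 1"
| "killed_kernel G K None (Some q) = 0"

definition markov_chain ::
  "'w measure \<Rightarrow> (nat \<Rightarrow> 'w \<Rightarrow> 's) \<Rightarrow> 's \<Rightarrow> ('s \<Rightarrow> 's \<Rightarrow> real) \<Rightarrow> bool" where
  "markov_chain M X s0 K \<longleftrightarrow>
     prob_space M \<and>
     (\<forall>t. X t \<in> measurable M (count_space UNIV)) \<and>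
     (AE w in M. X 0 w = s0) \<and>
     (\<forall>n h s. \<P>(w in M. \<forall>t\<le>n. X t w = h t) > 0 \<longrightarrow>
        \<P>(w in M. X (Suc n) w = s \<bar> \<forall>t\<le>n. X t w = h t) = K (h n) s)"

text \<open>The probability that \<open>X\<close> ever visits \<open>B\<close> and that its first visit to \<open>B\<close> is at \<open>q\<close>.\<close>

definition exit_prob ::
  "'w measure \<Rightarrow> (nat \<Rightarrow> 'w \<Rightarrow> (int \<times> int) option) \<Rightarrow> (int \<times> int) set \<Rightarrow> int \<times> int \<Rightarrow> real" where
  "exit_prob M X B q =
     \<P>(w in M. (\<exists>t. X t w \<in> Some ` B) \<and> X (LEAST t. X t w \<in> Some ` B) w = Some q)"

end

theory Submission
  imports Defs
begin

text \<open>Every column of the region is an interval. Let \<open>h\<^bsub>a\<^esub>(p)\<close> be the probability that the walk from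
  \<open>p\<close>, discounted by a factor \<open>z < 1\<close> per step, exits at \<open>a\<close>. The walks to \<open>(m, k - 1)\<close> are shifted up
  by one, which preserves their weights, so that they start above and end below the walks to
  \<open>(m, k + 1)\<close>. If the inequality failed, some \<open>c \<ge> 0\<close> would make \<open>c h\<^bsub>(m, k)\<^esub> - h\<^bsub>(m, k + 1)\<^esub>\<close> positive at
  the start \<open>(0, 1)\<close> in the shifted region and negative at the start \<open>(0, 0)\<close> in the original one. Let
  \<open>u\<close> be the same combination for the walk killed outside the intersection of the two regions. By
  the maximum principle \<open>u\<close> is positive at \<open>(0, 1)\<close> or next to the top rim of the shifted region,
  negative at \<open>(0, 0)\<close> or next to the bottom rim of the original one, and from these points
  \<open>{u > 0}\<close> reaches \<open>(m, k)\<close> and \<open>{u < 0}\<close> reaches \<open>(m, k + 1)\<close>. Such walks cross, a contradiction.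
  Finally \<open>z\<close> tends to 1.\<close>

section \<open>Crossing lattice walks\<close>

definition lattice_adj :: "int \<times> int \<Rightarrow> int \<times> int \<Rightarrow> bool" where
  "lattice_adj p q \<longleftrightarrow> \<bar>fst p - fst q\<bar> + \<bar>snd p - snd q\<bar> = 1"

text \<open>The step relation tests only its target, so membership of the start in \<open>S\<close>
  is a separate conjunct; without it the relation would not be symmetric.\<close>

definition linked :: "(int \<times> int) set \<Rightarrow> int \<times> int \<Rightarrow> int \<times> int \<Rightarrow> bool" where
  "linked S p q \<longleftrightarrow> p \<in> S \<and> (\<lambda>a b. lattice_adj a b \<and> b \<in> S)\<^sup>*\<^sup>* p q"

lemma lattice_adj_sym: "lattice_adj p q \<Longrightarrow> lattice_adj q p"
  by (simp add: lattice_adj_def abs_minus_commute)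

lemma linked_refl: "p \<in> S \<Longrightarrow> linked S p p"
  by (simp add: linked_def)

lemma linked_step: "linked S p q \<Longrightarrow> lattice_adj q r \<Longrightarrow> r \<in> S \<Longrightarrow> linked S p r"
  using rtranclp.rtrancl_into_rtrancl[of "\<lambda>a b. lattice_adj a b \<and> b \<in> S" p q r]
  by (simp add: linked_def)

lemma linked_induct [consumes 1, case_names refl step]:
  assumes "linked S p q" and "p \<in> S \<Longrightarrow> P p"
    and "\<And>q r. linked S p q \<Longrightarrow> P q \<Longrightarrow> lattice_adj q r \<Longrightarrow> r \<in> S \<Longrightarrow> P r"
  shows "P q"
proof -
  have "p \<in> S" "(\<lambda>a b. lattice_adj a b \<and> b \<in> S)\<^sup>*\<^sup>* p q"
    using assms(1) by (simp_all add: linked_def)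
  from this(2) have "linked S p q \<and> P q"
  proof (induction rule: rtranclp_induct)
    case base
    show ?case using \<open>p \<in> S\<close> assms(2) linked_refl by simp
  next
    case (step q r)
    then show ?case using assms(3) linked_step by blast
  qed
  then show ?thesis ..
qed

lemma linked_in: "linked S p q \<Longrightarrow> p \<in> S \<and> q \<in> S"
  by (induction rule: linked_induct) (simp_all add: linked_def)

lemma linked_trans: "linked S p q \<Longrightarrow> linked S q r \<Longrightarrow> linked S p r"
  unfolding linked_def by (meson rtranclp_trans)

lemma linked_sym: "linked S p q \<Longrightarrow> linked S q p"
proof (induction rule: linked_induct)
  case refl
  then show ?case by (simp add: linked_refl)
next
  case (step q r)
  then have "linked S r q"
    using linked_step[OF linked_refl, of r S q] lattice_adj_sym[of q r] linked_in[of S p q] by simp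
  then show ?case using step linked_trans[of S r q p] by simp
qed

lemma linked_mono: "linked S p q \<Longrightarrow> S \<subseteq> T \<Longrightarrow> linked T p q"
proof (induction rule: linked_induct)
  case refl then show ?case by (simp add: linked_refl subsetD)
next
  case (step q r) then show ?case using linked_step[of T p q r] by blast
qed

lemma linked_vertical:
  assumes "j \<le> j'" "\<And>y. j \<le> y \<Longrightarrow> y \<le> j' \<Longrightarrow> (i, y) \<in> S"
  shows "linked S (i, j) (i, j')"
  using assms
proof (induction j' rule: int_ge_induct)
  case base then show ?case by (simp add: linked_refl)
next
  case (step j')
  show ?case
    by (rule linked_step[of S "(i, j)" "(i, j')"]) (use step in \<open>auto simp: lattice_adj_def\<close>)
qed

lemma linked_horizontal:
  assumes "i \<le> i'" "\<And>x. i \<le> x \<Longrightarrow> x \<le> i' \<Longrightarrow> (x, j) \<in> S"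
  shows "linked S (i, j) (i', j)"
  using assms
proof (induction i' rule: int_ge_induct)
  case base then show ?case by (simp add: linked_refl)
next
  case (step i')
  show ?case
    by (rule linked_step[of S "(i, j)" "(i', j)"]) (use step in \<open>auto simp: lattice_adj_def\<close>)
qed

section \<open>Lattice walks as polygonal paths in the plane\<close>

definition vec_pt :: "int \<times> int \<Rightarrow> real ^ 2" where
  "vec_pt p = vector [of_int (fst p), of_int (snd p)]"

lemma vec_pt_nth [simp]: "vec_pt p $ 1 = of_int (fst p)" "vec_pt p $ 2 = of_int (snd p)"
  by (simp_all add: vec_pt_def)

lemma segment_vec_pt_bounds:
  assumes "z \<in> closed_segment (vec_pt p) (vec_pt q)"
  shows "of_int (min (fst p) (fst q)) \<le> z $ 1" "z $ 1 \<le> of_int (max (fst p) (fst q))"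
    "of_int (min (snd p) (snd q)) \<le> z $ 2" "z $ 2 \<le> of_int (max (snd p) (snd q))"
proof -
  obtain t where t: "0 \<le> t" "t \<le> 1" and z: "z = (1 - t) *\<^sub>R vec_pt p + t *\<^sub>R vec_pt q"
    using assms by (auto simp: in_segment)
  have bounds: "min x y \<le> (1 - t) * x + t * y \<and> (1 - t) * x + t * y \<le> max x y" for x y :: real
  proof -
    have "(1 - t) * min x y + t * min x y \<le> (1 - t) * x + t * y"
      using t by (intro add_mono mult_left_mono) auto
    moreover have "(1 - t) * x + t * y \<le> (1 - t) * max x y + t * max x y"
      using t by (intro add_mono mult_left_mono) auto
    ultimately show ?thesis by (simp add: algebra_simps)
  qed
  show "of_int (min (fst p) (fst q)) \<le> z $ 1" "z $ 1 \<le> of_int (max (fst p) (fst q))"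
    "of_int (min (snd p) (snd q)) \<le> z $ 2" "z $ 2 \<le> of_int (max (snd p) (snd q))"
    using bounds[of "of_int (fst p)" "of_int (fst q)"] bounds[of "of_int (snd p)" "of_int (snd q)"]
    by (simp_all add: z of_int_min of_int_max)
qed

text \<open>Adjacent or equal points differ by at most one, and in at most one coordinate, so their
  bounding box is a unit segment or a point and contains no further lattice point.\<close>

lemma lattice_box_endpoints:
  assumes "lattice_adj a b \<or> a = b"
    and "min (fst a) (fst b) \<le> fst v" "fst v \<le> max (fst a) (fst b)"
    and "min (snd a) (snd b) \<le> snd v" "snd v \<le> max (snd a) (snd b)"
  shows "v = a \<or> v = b"
proof -
  have "fst a = fst b \<and> \<bar>snd a - snd b\<bar> \<le> 1 \<or> \<bar>fst a - fst b\<bar> \<le> 1 \<and> snd a = snd b"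
    using assms(1) unfolding lattice_adj_def by auto
  then show ?thesis
  proof
    assume h: "fst a = fst b \<and> \<bar>snd a - snd b\<bar> \<le> 1"
    then have "fst v = fst a" "snd v = snd a \<or> snd v = snd b"
      using assms(2-5) unfolding min_le_iff_disj le_max_iff_disj by auto
    with h show ?thesis by (metis prod.collapse)
  next
    assume h: "\<bar>fst a - fst b\<bar> \<le> 1 \<and> snd a = snd b"
    then have "snd v = snd a" "fst v = fst a \<or> fst v = fst b"
      using assms(2-5) unfolding min_le_iff_disj le_max_iff_disj by auto
    with h show ?thesis by (metis prod.collapse)
  qed
qed

text \<open>A common point forces the bounding boxes of the two segments to overlap. Their corners
  are integral, so the overlap contains a lattice point, which can only be an endpoint of each
  segment.\<close>

lemma lattice_segments_share_endpoint:
  assumes "lattice_adj a b \<or> a = b" "lattice_adj c d \<or> c = d"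
    and "z \<in> closed_segment (vec_pt a) (vec_pt b)" "z \<in> closed_segment (vec_pt c) (vec_pt d)"
  shows "{a, b} \<inter> {c, d} \<noteq> {}"
proof -
  note bounds = segment_vec_pt_bounds[OF assms(3)] segment_vec_pt_bounds[OF assms(4)]
  have int_bounds:
    "min (fst a) (fst b) \<le> max (fst c) (fst d)" "min (fst c) (fst d) \<le> max (fst a) (fst b)"
    "min (snd a) (snd b) \<le> max (snd c) (snd d)" "min (snd c) (snd d) \<le> max (snd a) (snd b)"
    using order_trans[OF bounds(1,6)] order_trans[OF bounds(5,2)] order_trans[OF bounds(3,8)]
      order_trans[OF bounds(7,4)] by (simp_all only: of_int_le_iff)
  define v where "v = (max (min (fst a) (fst b)) (min (fst c) (fst d)),
    max (min (snd a) (snd b)) (min (snd c) (snd d)))"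
  have "v = a \<or> v = b"
    using int_bounds by (intro lattice_box_endpoints[OF assms(1)]) (auto simp: v_def min_le_iff_disj)
  moreover have "v = c \<or> v = d"
    using int_bounds by (intro lattice_box_endpoints[OF assms(2)]) (auto simp: v_def min_le_iff_disj)
  ultimately show ?thesis by auto
qed

text \<open>Unit segments along the walk are concatenated. The alternative \<open>a = b\<close>
  covers the walk of length zero, whose path is constant.\<close>

lemma linked_polygonal_path:
  assumes "linked S p q"
  obtains g where "path g" "pathstart g = vec_pt p" "pathfinish g = vec_pt q"
    "\<And>z. z \<in> path_image g \<Longrightarrow>
       \<exists>a\<in>S. \<exists>b\<in>S. (lattice_adj a b \<or> a = b) \<and> z \<in> closed_segment (vec_pt a) (vec_pt b)"
proof -
  have "\<exists>g. path g \<and> pathstart g = vec_pt p \<and> pathfinish g = vec_pt q \<and>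
    (\<forall>z\<in>path_image g.
       \<exists>a\<in>S. \<exists>b\<in>S. (lattice_adj a b \<or> a = b) \<and> z \<in> closed_segment (vec_pt a) (vec_pt b))"
    using assms
  proof (induction rule: linked_induct)
    case refl
    then show ?case
      by (intro exI[of _ "linepath (vec_pt p) (vec_pt p)"] conjI path_linepath pathstart_linepath
          pathfinish_linepath) auto
  next
    case (step q r)
    then obtain g where g: "path g" "pathstart g = vec_pt p" "pathfinish g = vec_pt q"
      "\<forall>z\<in>path_image g.
       \<exists>a\<in>S. \<exists>b\<in>S. (lattice_adj a b \<or> a = b) \<and> z \<in> closed_segment (vec_pt a) (vec_pt b)"
      by blast
    have "q \<in> S" using step linked_in by blast
    with g step show ?case
      by (intro exI[of _ "g +++ linepath (vec_pt q) (vec_pt r)"])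
        (auto simp: path_image_join)
  qed
  then show ?thesis using that by blast
qed

text \<open>A left-right path and a bottom-top path in a rectangle intersect, by the Fashoda
  theorem; it is stated for \<open>real ^ 2\<close>, hence the embedding \<open>vec_pt\<close>. The
  intersection point lies on a segment of each walk, and two such segments that meet share a lattice
  point.\<close>

lemma crossing_walks_meet:
  assumes S: "linked S (x0, c) (x1, d)" and T: "linked T (e, y0) (f, y1)"
    and "\<And>p. p \<in> S \<union> T \<Longrightarrow> x0 \<le> fst p \<and> fst p \<le> x1 \<and> y0 \<le> snd p \<and> snd p \<le> y1"
  shows "S \<inter> T \<noteq> {}"
proof -
  obtain g where g: "path g" "pathstart g = vec_pt (x0, c)" "pathfinish g = vec_pt (x1, d)"
    "\<And>z. z \<in> path_image g \<Longrightarrow>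
       \<exists>a\<in>S. \<exists>b\<in>S. (lattice_adj a b \<or> a = b) \<and> z \<in> closed_segment (vec_pt a) (vec_pt b)"
    using linked_polygonal_path[OF S] by blast
  obtain h where h: "path h" "pathstart h = vec_pt (e, y0)" "pathfinish h = vec_pt (f, y1)"
    "\<And>z. z \<in> path_image h \<Longrightarrow>
       \<exists>a\<in>T. \<exists>b\<in>T. (lattice_adj a b \<or> a = b) \<and> z \<in> closed_segment (vec_pt a) (vec_pt b)"
    using linked_polygonal_path[OF T] by blast
  have box: "z \<in> cbox (vec_pt (x0, y0)) (vec_pt (x1, y1))"
    if "a \<in> S \<union> T" "b \<in> S \<union> T" "z \<in> closed_segment (vec_pt a) (vec_pt b)" for a b z
  proof -
    have "x0 \<le> min (fst a) (fst b)" "max (fst a) (fst b) \<le> x1"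
      "y0 \<le> min (snd a) (snd b)" "max (snd a) (snd b) \<le> y1"
      using assms(3)[OF that(1)] assms(3)[OF that(2)] by auto
    note le = this[THEN iffD2[OF of_int_le_iff[where 'a = real]]]
    have "real_of_int x0 \<le> z $ 1 \<and> z $ 1 \<le> x1 \<and> y0 \<le> z $ 2 \<and> z $ 2 \<le> y1"
      using le segment_vec_pt_bounds[OF that(3)] by (meson order_trans)
    then show ?thesis by (simp add: mem_box_cart forall_2)
  qed
  obtain z where z: "z \<in> path_image g" "z \<in> path_image h"
  proof (rule fashoda[of g h "vec_pt (x0, y0)" "vec_pt (x1, y1)"])
    show "path_image g \<subseteq> cbox (vec_pt (x0, y0)) (vec_pt (x1, y1))" using g(4) box by blast
    show "path_image h \<subseteq> cbox (vec_pt (x0, y0)) (vec_pt (x1, y1))" using h(4) box by blast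
  qed (use g h in auto)
  obtain a b where ab: "a \<in> S" "b \<in> S" "lattice_adj a b \<or> a = b" "z \<in> closed_segment (vec_pt a) (vec_pt b)"
    using g(4)[OF z(1)] by blast
  obtain a' b' where ab': "a' \<in> T" "b' \<in> T" "lattice_adj a' b' \<or> a' = b'" "z \<in> closed_segment (vec_pt a') (vec_pt b')"
    using h(4)[OF z(2)] by blast
  show ?thesis
    using lattice_segments_share_endpoint[OF ab(3) ab'(3) ab(4) ab'(4)] ab ab' by auto
qed

section \<open>The columns of the region\<close>

lemma closed_segment_horizontal:
  "closed_segment (plane_pt (i, j)) (plane_pt (i + 1, j)) = {real_of_int i..real_of_int (i + 1)} \<times> {real_of_int j}"
proof (intro set_eqI iffI)
  fix p assume "p \<in> closed_segment (plane_pt (i, j)) (plane_pt (i + 1, j))"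
  then obtain t where "0 \<le> t" "t \<le> 1" "p = (1 - t) *\<^sub>R plane_pt (i, j) + t *\<^sub>R plane_pt (i + 1, j)"
    by (auto simp: in_segment)
  then show "p \<in> {real_of_int i..real_of_int (i + 1)} \<times> {real_of_int j}"
    by (simp add: plane_pt_def algebra_simps)
next
  fix p assume "p \<in> {real_of_int i..real_of_int (i + 1)} \<times> {real_of_int j}"
  then show "p \<in> closed_segment (plane_pt (i, j)) (plane_pt (i + 1, j))"
    unfolding in_segment
    by (intro exI[of _ "fst p - i"]) (auto simp: plane_pt_def algebra_simps)
qed

lemma closed_segment_vertical:
  assumes "j \<le> j'"
  shows "closed_segment (plane_pt (i, j)) (plane_pt (i, j')) = {real_of_int i} \<times> {real_of_int j..real_of_int j'}"
proof (intro set_eqI iffI)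
  fix p assume "p \<in> closed_segment (plane_pt (i, j)) (plane_pt (i, j'))"
  then obtain t where t: "0 \<le> t" "t \<le> 1" "p = (1 - t) *\<^sub>R plane_pt (i, j) + t *\<^sub>R plane_pt (i, j')"
    by (auto simp: in_segment)
  have "t * (real_of_int j' - j) \<le> 1 * (real_of_int j' - j)" using t assms by (intro mult_right_mono) auto
  moreover have "0 \<le> t * (real_of_int j' - j)" using t assms by simp
  ultimately show "p \<in> {real_of_int i} \<times> {real_of_int j..real_of_int j'}"
    using t by (simp add: plane_pt_def algebra_simps)
next
  fix p assume p: "p \<in> {real_of_int i} \<times> {real_of_int j..real_of_int j'}"
  have "snd p \<in> closed_segment (real_of_int j) (real_of_int j')"
    using p assms by (auto simp: closed_segment_eq_real_ivl)
  then obtain t :: real where t: "0 \<le> t" "t \<le> 1" "snd p = (1 - t) * j + t * j'" by (auto simp: in_segment)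
  then show "p \<in> closed_segment (plane_pt (i, j)) (plane_pt (i, j'))"
    using p unfolding in_segment
    by (intro exI[of _ t]) (auto simp: plane_pt_def algebra_simps prod_eq_iff)
qed

lemma unit_distance_cases:
  assumes "dist (plane_pt p) (plane_pt q) = 1"
  shows "q = (fst p + 1, snd p) \<or> q = (fst p - 1, snd p) \<or> q = (fst p, snd p + 1) \<or> q = (fst p, snd p - 1)"
proof -
  define d e where "d = fst p - fst q" and "e = snd p - snd q"
  have "real_of_int (d\<^sup>2 + e\<^sup>2) = 1"
    using assms by (simp add: plane_pt_def dist_Pair_Pair dist_real_def d_def e_def)
  then have sq: "d\<^sup>2 + e\<^sup>2 = 1" by linarith
  then have "d\<^sup>2 \<le> 1" "e\<^sup>2 \<le> 1" using zero_le_power2[of d] zero_le_power2[of e] by linarith+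
  then have "\<bar>d\<bar> \<le> 1" "\<bar>e\<bar> \<le> 1" by (simp_all add: abs_square_le_1)
  then have "d = -1 \<or> d = 0 \<or> d = 1" "e = -1 \<or> e = 0 \<or> e = 1" by linarith+
  then have "(e = 0 \<and> (d = 1 \<or> d = -1)) \<or> (d = 0 \<and> (e = 1 \<or> e = -1))" using sq by auto
  then show ?thesis by (auto simp: d_def e_def prod_eq_iff)
qed

text \<open>\<open>h i\<close> is the height of the step from column \<open>i\<close> to column \<open>i + 1\<close>, and \<open>lo i\<close> and \<open>hi i\<close> bound the
  vertical run in column \<open>i\<close>; the run may overshoot both of the adjacent steps.\<close>

definition path_columns ::
  "(real \<times> real) set \<Rightarrow> int \<Rightarrow> int \<Rightarrow> (int \<Rightarrow> int) \<Rightarrow> (int \<Rightarrow> int) \<Rightarrow> (int \<Rightarrow> int) \<Rightarrow> bool" where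
  "path_columns T s m lo hi h \<longleftrightarrow> s \<le> m \<and>
     (\<forall>i\<in>{s..m}. lo i \<le> hi i) \<and>
     (\<forall>i\<in>{s..<m}. lo i \<le> h i \<and> h i \<le> hi i \<and> lo (i + 1) \<le> h i \<and> h i \<le> hi (i + 1)) \<and>
     T = (\<Union>i\<in>{s..m}. {real_of_int i} \<times> {real_of_int (lo i)..real_of_int (hi i)}) \<union>
       (\<Union>i\<in>{s..<m}. {real_of_int i..real_of_int (i + 1)} \<times> {real_of_int (h i)})"

section \<open>Column decomposition of monotone paths\<close>

lemma path_trace_Cons:
  assumes "ps \<noteq> []"
  shows "path_trace (p # ps) = closed_segment (plane_pt p) (plane_pt (hd ps)) \<union> path_trace ps"
proof -
  have "{t. Suc t < length (p # ps)} = insert 0 (Suc ` {t. Suc t < length ps})"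
  proof (intro set_eqI)
    fix t
    show "t \<in> {t. Suc t < length (p # ps)} \<longleftrightarrow> t \<in> insert 0 (Suc ` {t. Suc t < length ps})"
      using assms by (cases t) auto
  qed
  then have "(\<Union>t\<in>{t. Suc t < length (p # ps)}.
      closed_segment (plane_pt ((p # ps) ! t)) (plane_pt ((p # ps) ! Suc t))) =
    closed_segment (plane_pt p) (plane_pt (hd ps)) \<union>
    (\<Union>t\<in>{t. Suc t < length ps}. closed_segment (plane_pt (ps ! t)) (plane_pt (ps ! Suc t)))"
    using assms by (simp add: hd_conv_nth)
  moreover have "plane_pt p \<in> closed_segment (plane_pt p) (plane_pt (hd ps))" by simp
  ultimately show ?thesis unfolding path_trace_def by auto
qed

lemma UN_int_Suc:
  fixes s m :: int
  shows "s < m \<Longrightarrow> (\<Union>i\<in>{s..<m}. A i) = A s \<union> (\<Union>i\<in>{s + 1..<m}. A i)"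
    and "s \<le> m \<Longrightarrow> (\<Union>i\<in>{s..m}. A i) = A s \<union> (\<Union>i\<in>{s + 1..m}. A i)"
proof -
  assume "s < m"
  then have "{s..<m} = insert s {s + 1..<m}" by auto
  then show "(\<Union>i\<in>{s..<m}. A i) = A s \<union> (\<Union>i\<in>{s + 1..<m}. A i)" by simp
next
  assume "s \<le> m"
  then have "{s..m} = insert s {s + 1..m}" by auto
  then show "(\<Union>i\<in>{s..m}. A i) = A s \<union> (\<Union>i\<in>{s + 1..m}. A i)" by simp
qed

text \<open>The old start lies in the run of column \<open>s\<close>, so the union of the new step
  and the run is again an interval. It grows by at most one unit; \<open>min\<close> and
  \<open>max\<close> also cover a step that stays within the run.\<close>

lemma path_columns_vertical_step:
  assumes cols: "path_columns T s m lo hi h" and y: "lo s \<le> j" "j \<le> hi s"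
    and j': "j' = j + 1 \<or> j' = j - 1"
  shows "path_columns (closed_segment (plane_pt (s, j')) (plane_pt (s, j)) \<union> T) s m
    (lo(s := min (lo s) j')) (hi(s := max (hi s) j')) h"
proof -
  have seg: "closed_segment (plane_pt (s, j')) (plane_pt (s, j)) =
      {real_of_int s} \<times> {real_of_int (min j j')..real_of_int (max j j')}"
    using closed_segment_vertical[of j j' s] closed_segment_vertical[of j' j s] j'
    by (auto simp: closed_segment_commute)
  have "{real_of_int (min j j')..real_of_int (max j j')} \<union> {real_of_int (lo s)..real_of_int (hi s)} =
      {real_of_int (min (lo s) j')..real_of_int (max (hi s) j')}"
    using j'
  proof
    assume "j' = j + 1"
    moreover from this have "j' \<le> hi s \<or> hi s = j" using y by linarith
    ultimately show ?thesis using y by auto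
  next
    assume "j' = j - 1"
    moreover from this have "lo s \<le> j' \<or> lo s = j" using y by linarith
    ultimately show ?thesis using y by auto
  qed
  then have eq: "closed_segment (plane_pt (s, j')) (plane_pt (s, j)) \<union>
      {real_of_int s} \<times> {real_of_int (lo s)..real_of_int (hi s)} =
      {real_of_int s} \<times> {real_of_int (min (lo s) j')..real_of_int (max (hi s) j')}"
    unfolding seg by (simp flip: Sigma_Un_distrib2)
  have "s \<le> m" using cols by (simp add: path_columns_def)
  have rest: "(\<Union>i\<in>{s + 1..m}. {real_of_int i} \<times> {real_of_int ((lo(s := min (lo s) j')) i)..real_of_int ((hi(s := max (hi s) j')) i)})
    = (\<Union>i\<in>{s + 1..m}. {real_of_int i} \<times> {real_of_int (lo i)..real_of_int (hi i)})"
    by (intro SUP_cong) auto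
  have T: "T = {real_of_int s} \<times> {real_of_int (lo s)..real_of_int (hi s)} \<union>
      (\<Union>i\<in>{s + 1..m}. {real_of_int i} \<times> {real_of_int (lo i)..real_of_int (hi i)}) \<union>
      (\<Union>i\<in>{s..<m}. {real_of_int i..real_of_int (i + 1)} \<times> {real_of_int (h i)})"
    using cols UN_int_Suc(2)[OF \<open>s \<le> m\<close>, of "\<lambda>i. {real_of_int i} \<times> {real_of_int (lo i)..real_of_int (hi i)}"]
    by (simp add: path_columns_def)
  have "closed_segment (plane_pt (s, j')) (plane_pt (s, j)) \<union> T =
    (\<Union>i\<in>{s..m}. {real_of_int i} \<times> {real_of_int ((lo(s := min (lo s) j')) i)..real_of_int ((hi(s := max (hi s) j')) i)}) \<union>
       (\<Union>i\<in>{s..<m}. {real_of_int i..real_of_int (i + 1)} \<times> {real_of_int (h i)})"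
    unfolding UN_int_Suc(2)[OF \<open>s \<le> m\<close>] rest unfolding T by (simp only: Un_assoc[symmetric] eq fun_upd_same)
  then show ?thesis using cols unfolding path_columns_def by (auto simp: min_le_iff_disj le_max_iff_disj)
qed

lemma path_columns_horizontal_step:
  assumes cols: "path_columns T (s + 1) m lo hi h" and y: "lo (s + 1) \<le> j" "j \<le> hi (s + 1)"
  shows "path_columns (closed_segment (plane_pt (s, j)) (plane_pt (s + 1, j)) \<union> T) s m
    (lo(s := j)) (hi(s := j)) (h(s := j))"
proof -
  have "s < m" using cols by (simp add: path_columns_def)
  have rest: "(\<Union>i\<in>{s + 1..m}. {real_of_int i} \<times> {real_of_int ((lo(s := j)) i)..real_of_int ((hi(s := j)) i)})
    = (\<Union>i\<in>{s + 1..m}. {real_of_int i} \<times> {real_of_int (lo i)..real_of_int (hi i)})"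
    by (intro SUP_cong) auto
  have rest': "(\<Union>i\<in>{s + 1..<m}. {real_of_int i..real_of_int (i + 1)} \<times> {real_of_int ((h(s := j)) i)})
    = (\<Union>i\<in>{s + 1..<m}. {real_of_int i..real_of_int (i + 1)} \<times> {real_of_int (h i)})"
    by (intro SUP_cong) auto
  have "closed_segment (plane_pt (s, j)) (plane_pt (s + 1, j)) \<union> T =
    (\<Union>i\<in>{s..m}. {real_of_int i} \<times> {real_of_int ((lo(s := j)) i)..real_of_int ((hi(s := j)) i)}) \<union>
       (\<Union>i\<in>{s..<m}. {real_of_int i..real_of_int (i + 1)} \<times> {real_of_int ((h(s := j)) i)})"
    unfolding UN_int_Suc(1)[OF \<open>s < m\<close>] UN_int_Suc(2)[OF less_imp_le[OF \<open>s < m\<close>]] rest rest'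
      closed_segment_horizontal
    using cols by (auto simp: path_columns_def)
  then show ?thesis using cols y \<open>s < m\<close> unfolding path_columns_def by auto
qed

text \<open>Induction from the front of the path. By monotonicity the first step goes right, which
  opens a new column, or is vertical, which extends the run of the first column. That the endpoints
  lie in their runs is carried along: the front one serves to attach the next step, and both serve
  later to attach the vertical sides.\<close>

lemma x_monotone_path_columns:
  assumes "x_monotone_path ps" "hd ps = (s, a)" "last ps = (m, b)"
  shows "\<exists>lo hi h. path_columns (path_trace ps) s m lo hi h \<and>
    lo s \<le> a \<and> a \<le> hi s \<and> lo m \<le> b \<and> b \<le> hi m"
  using assms
proof (induction ps arbitrary: s a)
  case Nil
  then show ?case by (simp add: x_monotone_path_def lattice_path_def)
next
  case (Cons p ps)
  then have p: "p = (s, a)" by simp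
  show ?case
  proof (cases "ps = []")
    case True
    then have "m = s" "b = a" using Cons by auto
    moreover have "path_columns (path_trace [(s, a)]) s s (\<lambda>_. a) (\<lambda>_. a) (\<lambda>_. a)"
      by (auto simp: path_columns_def path_trace_def plane_pt_def)
    ultimately show ?thesis using True p by (intro exI[of _ "\<lambda>_. a"]) auto
  next
    case False
    then have step: "dist (plane_pt p) (plane_pt (hd ps)) = 1" and mono: "s \<le> fst (hd ps)"
      and "x_monotone_path ps"
      using Cons.prems(1) p
      by (auto simp: x_monotone_path_def lattice_path_def successively_Cons)
    obtain s' a' where q: "hd ps = (s', a')" by fastforce
    obtain lo hi h where cols: "path_columns (path_trace ps) s' m lo hi h"
      and ends: "lo s' \<le> a'" "a' \<le> hi s'" "lo m \<le> b" "b \<le> hi m"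
      using Cons.IH[OF \<open>x_monotone_path ps\<close> q] Cons.prems(3) False by auto
    have "s' \<le> m" using cols by (simp add: path_columns_def)
    note trace = path_trace_Cons[OF False, of p, unfolded q p]
    consider "s' = s + 1" "a' = a" | "s' = s" "a = a' - 1 \<or> a = a' + 1"
      using unit_distance_cases[OF step] mono by (auto simp: p q)
    then show ?thesis
    proof cases
      case 1
      have "path_columns (path_trace (p # ps)) s m (lo(s := a)) (hi(s := a)) (h(s := a))"
        using path_columns_horizontal_step[of "path_trace ps" s m lo hi h a] cols ends trace 1
        by (simp add: p)
      moreover have "(lo(s := a)) m \<le> b" "b \<le> (hi(s := a)) m"
        using ends 1 \<open>s' \<le> m\<close> by simp_all
      ultimately show ?thesis by (metis fun_upd_same order_refl)
    next
      case 2
      have "path_columns (path_trace (p # ps)) s m (lo(s := min (lo s) a)) (hi(s := max (hi s) a)) h"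
        using path_columns_vertical_step[of "path_trace ps" s m lo hi h a' a] cols ends trace 2
        by (auto simp add: p)
      moreover have "(lo(s := min (lo s) a)) m \<le> b" "b \<le> (hi(s := max (hi s) a)) m"
        using ends by auto
      moreover have "(lo(s := min (lo s) a)) s \<le> a" "a \<le> (hi(s := max (hi s) a)) s"
        by simp_all
      ultimately show ?thesis by blast
    qed
  qed
qed

text \<open>Both vertical sides are absorbed into the column hulls. Off the boundary curve, a point of the
  hull of an inner column lies above the lower and below the upper path, and so do the points near
  it; hence the frontier of the hull is contained in the curve.\<close>

lemma enclosed_region_columns:
  assumes "0 < m" "a0 \<le> a1" "b0 \<le> b1"
    and up: "x_monotone_path etap" "hd etap = (0, a1)" "last etap = (m, b1)"
    and down: "x_monotone_path etam" "hd etam = (0, a0)" "last etam = (m, b0)"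
    and "weakly_above etap etam"
  shows "\<exists>l u. (\<forall>i. 0 \<le> i \<and> i \<le> m \<longrightarrow> l i \<le> u i) \<and>
    enclosed_region (boundary_curve m a0 a1 b0 b1 etap etam) =
      {p. 0 \<le> fst p \<and> fst p \<le> m \<and> l (fst p) \<le> snd p \<and> snd p \<le> u (fst p)}"
proof -
  obtain lo hi h where P: "path_columns (path_trace etap) 0 m lo hi h"
    "lo 0 \<le> a1" "a1 \<le> hi 0" "lo m \<le> b1" "b1 \<le> hi m"
    using x_monotone_path_columns[OF up] by blast
  obtain lo' hi' h' where Q: "path_columns (path_trace etam) 0 m lo' hi' h'"
    "lo' 0 \<le> a0" "a0 \<le> hi' 0" "lo' m \<le> b0" "b0 \<le> hi' m"
    using x_monotone_path_columns[OF down] by blast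
  define C where "C = boundary_curve m a0 a1 b0 b1 etap etam"
  define l where "l i = min (lo i) (lo' i)" for i
  define u where "u i = max (hi i) (hi' i)" for i
  have lohi: "lo i \<le> hi i" "lo' i \<le> hi' i" if "0 \<le> i" "i \<le> m" for i
    using P(1) Q(1) that by (auto simp: path_columns_def)
  have hP: "lo i \<le> h i" "h i \<le> hi i" "lo (i + 1) \<le> h i" "h i \<le> hi (i + 1)"
    and hQ: "lo' i \<le> h' i" "h' i \<le> hi' i" "lo' (i + 1) \<le> h' i" "h' i \<le> hi' (i + 1)"
    if "0 \<le> i" "i < m" for i
    using P(1) Q(1) that by (auto simp: path_columns_def)
  have C_eq: "C =
      {0} \<times> {real_of_int a0..real_of_int a1} \<union> {real_of_int m} \<times> {real_of_int b0..real_of_int b1} \<union>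
      (\<Union>i\<in>{0..m}. {real_of_int i} \<times> {real_of_int (lo i)..real_of_int (hi i)}) \<union>
      (\<Union>i\<in>{0..<m}. {real_of_int i..real_of_int (i + 1)} \<times> {real_of_int (h i)}) \<union>
      (\<Union>i\<in>{0..m}. {real_of_int i} \<times> {real_of_int (lo' i)..real_of_int (hi' i)}) \<union>
      (\<Union>i\<in>{0..<m}. {real_of_int i..real_of_int (i + 1)} \<times> {real_of_int (h' i)})"
    using P(1) Q(1) closed_segment_vertical[OF \<open>a0 \<le> a1\<close>, of 0] closed_segment_vertical[OF \<open>b0 \<le> b1\<close>, of m]
    by (simp add: C_def boundary_curve_def path_columns_def Un_ac)
  have "C = A1 \<union> A2 \<union> A3 \<union> A4 \<union> A5 \<union> A6 \<Longrightarrow>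
    A1 \<subseteq> C \<and> A2 \<subseteq> C \<and> A3 \<subseteq> C \<and> A4 \<subseteq> C \<and> A5 \<subseteq> C \<and> A6 \<subseteq> C" for A1 A2 A3 A4 A5 A6
    by blast
  note parts = this[OF C_eq]
  have C_mem: "(0, y) \<in> C" if "a0 \<le> y" "y \<le> a1" for y :: real
    by (rule subsetD[OF conjunct1[OF parts]]) (use that in simp)
  have C_mem': "(real_of_int m, y) \<in> C" if "b0 \<le> y" "y \<le> b1" for y :: real
    by (rule subsetD[OF conjunct1[OF conjunct2[OF parts]]]) (use that in simp)
  have C_up: "(real_of_int i, y) \<in> C" if "0 \<le> i" "i \<le> m" "lo i \<le> y" "y \<le> hi i" for i and y :: real
    by (rule subsetD[OF conjunct1[OF conjunct2[OF conjunct2[OF parts]]]], rule UN_I[of i]) (use that in simp_all)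
  have C_step: "(x, real_of_int (h i)) \<in> C"
    if "0 \<le> i" "i < m" "i \<le> x" "x \<le> real_of_int (i + 1)" for i and x :: real
    by (rule subsetD[OF conjunct1[OF conjunct2[OF conjunct2[OF conjunct2[OF parts]]]]], rule UN_I[of i])
      (use that in simp_all)
  have C_down: "(real_of_int i, y) \<in> C" if "0 \<le> i" "i \<le> m" "lo' i \<le> y" "y \<le> hi' i" for i and y :: real
    by (rule subsetD[OF conjunct1[OF conjunct2[OF conjunct2[OF conjunct2[OF conjunct2[OF parts]]]]]],
        rule UN_I[of i]) (use that in simp_all)
  have C_step': "(x, real_of_int (h' i)) \<in> C"
    if "0 \<le> i" "i < m" "i \<le> x" "x \<le> real_of_int (i + 1)" for i and x :: real
    by (rule subsetD[OF conjunct2[OF conjunct2[OF conjunct2[OF conjunct2[OF conjunct2[OF parts]]]]]],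
        rule UN_I[of i]) (use that in simp_all)
  \<comment> \<open>At the midpoint of the unit interval, a non-integral abscissa, the traces
    contain the horizontal steps, so the assumption on the paths compares \<open>h'\<close> with
    \<open>h\<close>.\<close>
  have hh: "h' i \<le> h i" if "0 \<le> i" "i < m" for i
  proof -
    have on_step: "(real_of_int i + 1/2, real_of_int (g i)) \<in> T" if T: "path_columns T 0 m f f' g" for T f f' g
    proof -
      have "T = (\<Union>i\<in>{0..m}. {real_of_int i} \<times> {real_of_int (f i)..real_of_int (f' i)}) \<union>
          (\<Union>i\<in>{0..<m}. {real_of_int i..real_of_int (i + 1)} \<times> {real_of_int (g i)})"
        using T unfolding path_columns_def by blast
      moreover have "(real_of_int i + 1/2, real_of_int (g i)) \<in>
          (\<Union>i\<in>{0..<m}. {real_of_int i..real_of_int (i + 1)} \<times> {real_of_int (g i)})"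
        by (rule UN_I[of i]) (use \<open>0 \<le> i\<close> \<open>i < m\<close> in simp_all)
      ultimately show ?thesis by blast
    qed
    have "real_of_int i + 1/2 \<notin> \<int>"
    proof
      assume "real_of_int i + 1/2 \<in> \<int>"
      then obtain n where "real_of_int i + 1/2 = real_of_int n" by (auto elim: Ints_cases)
      then have "real_of_int (2 * i + 1) = real_of_int (2 * n)" by simp
      then have "2 * i + 1 = 2 * n" by (simp only: of_int_eq_iff)
      then show False by presburger
    qed
    then have "real_of_int (h' i) \<le> real_of_int (h i)"
      using \<open>weakly_above etap etam\<close> on_step[OF P(1)] on_step[OF Q(1)]
      unfolding weakly_above_def by blast
    then show ?thesis by simp
  qed
  \<comment> \<open>\<open>R\<close> fills the curve: the hull of each lattice column together with
    the slab between the two horizontal steps over each unit interval.\<close>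
  define R where "R = (\<Union>i\<in>{0..m}. {real_of_int i} \<times> {real_of_int (l i)..real_of_int (u i)}) \<union>
    (\<Union>i\<in>{0..<m}. {real_of_int i..real_of_int (i + 1)} \<times> {real_of_int (h' i)..real_of_int (h i)})"
  have "compact R"
    unfolding R_def by (intro compact_Un compact_UN compact_Times) auto
  have column: "real_of_int (l i) \<le> y \<and> y \<le> real_of_int (u i) \<and> 0 \<le> i \<and> i \<le> m"
    if iy: "(real_of_int i, y) \<in> C" for i y
  proof -
    \<comment> \<open>Membership in \<open>B\<close> restricts only points of integral abscissa.
      Each piece of \<open>C\<close> can then be checked separately; a horizontal step meets just
      the columns at its two ends.\<close>
    define B where "B = {p. \<forall>i. fst p = real_of_int i \<longrightarrow>
      real_of_int (l i) \<le> snd p \<and> snd p \<le> real_of_int (u i) \<and> 0 \<le> i \<and> i \<le> m}"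
    have step: "{real_of_int j..real_of_int (j + 1)} \<times> {real_of_int g} \<subseteq> B"
      if j: "0 \<le> j" "j < m" and g: "l j \<le> g" "g \<le> u j" "l (j + 1) \<le> g" "g \<le> u (j + 1)" for j g
    proof
      fix p assume p: "p \<in> {real_of_int j..real_of_int (j + 1)} \<times> {real_of_int g}"
      have "real_of_int (l i) \<le> snd p \<and> snd p \<le> real_of_int (u i) \<and> 0 \<le> i \<and> i \<le> m"
        if i: "fst p = real_of_int i" for i
      proof -
        have "real_of_int j \<le> real_of_int i" "real_of_int i \<le> real_of_int (j + 1)"
          using p i by auto
        then have "i = j \<or> i = j + 1" unfolding of_int_le_iff by linarith
        then show ?thesis using p j g by auto
      qed
      then show "p \<in> B" by (simp add: B_def)
    qed
    have "C \<subseteq> B"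
      unfolding C_eq
    proof (intro Un_least UN_least)
      show "{0} \<times> {real_of_int a0..real_of_int a1} \<subseteq> B"
        using P Q \<open>0 < m\<close> by (auto simp: B_def l_def u_def)
      show "{real_of_int m} \<times> {real_of_int b0..real_of_int b1} \<subseteq> B"
        using P Q \<open>0 < m\<close> by (auto simp: B_def l_def u_def)
      fix j assume "j \<in> {0..m}"
      then show "{real_of_int j} \<times> {real_of_int (lo j)..real_of_int (hi j)} \<subseteq> B"
        "{real_of_int j} \<times> {real_of_int (lo' j)..real_of_int (hi' j)} \<subseteq> B"
        by (auto simp: B_def l_def u_def)
    next
      fix j assume "j \<in> {0..<m}"
      then have j: "0 \<le> j" "j < m" by auto
      show "{real_of_int j..real_of_int (j + 1)} \<times> {real_of_int (h j)} \<subseteq> B"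
        using hP[OF j] by (intro step[OF j]) (auto simp: l_def u_def)
      show "{real_of_int j..real_of_int (j + 1)} \<times> {real_of_int (h' j)} \<subseteq> B"
        using hQ[OF j] by (intro step[OF j]) (auto simp: l_def u_def)
    qed
    then show ?thesis using iy by (auto simp: B_def)
  qed
  have on_column: "(real_of_int i, y) \<in> interior R"
    if i: "0 \<le> i" "i \<le> m" and y: "real_of_int (l i) \<le> y" "y \<le> real_of_int (u i)"
      and "(real_of_int i, y) \<notin> C" for i y
  proof -
    have off: "\<not> (lo i \<le> y \<and> y \<le> hi i)" "\<not> (lo' i \<le> y \<and> y \<le> hi' i)"
      using that(5) C_up[OF i, of y] C_down[OF i, of y] by linarith+
    have y': "lo i \<le> y \<or> lo' i \<le> y" "y \<le> hi i \<or> y \<le> hi' i"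
      using y unfolding l_def u_def of_int_min of_int_max min_le_iff_disj le_max_iff_disj .
    \<comment> \<open>There is no gap with the upper run below the lower one: each run contains the
      height of an adjacent horizontal step, and these heights are ordered. In the last column the
      step on the left is used, which exists because \<open>0 < m\<close>.\<close>
    have "\<not> hi i < lo' i"
    proof (cases "i < m")
      case True
      then show ?thesis using hP[of i] hQ[of i] hh[of i] i by linarith
    next
      case False
      then show ?thesis using hP[of "i - 1"] hQ[of "i - 1"] hh[of "i - 1"] i \<open>0 < m\<close> by auto
    qed
    then have "\<not> (hi i < y \<and> y < lo' i)" by linarith
    then have between: "hi' i < y" "y < lo i" using off y' not_le by blast+
    \<comment> \<open>In the first and the last column the gap between the two runs is covered by a
      vertical side of the curve.\<close>
    have "i \<noteq> 0"
    proof
      assume "i = 0"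
      moreover from this have "real_of_int a0 \<le> y" "y \<le> real_of_int a1" using between P(2) Q(3) by auto
      ultimately show False using that(5) C_mem by simp
    qed
    have "i \<noteq> m"
    proof
      assume "i = m"
      moreover from this have "real_of_int b0 \<le> y" "y \<le> real_of_int b1" using between P(4) Q(5) by auto
      ultimately show False using that(5) C_mem' by simp
    qed
    have bounds: "h' i \<le> hi' i" "lo i \<le> h i" "h' (i - 1) \<le> hi' i" "lo i \<le> h (i - 1)"
      using hP[of i] hQ[of i] hP[of "i - 1"] hQ[of "i - 1"] i \<open>i \<noteq> 0\<close> \<open>i \<noteq> m\<close> by auto
    show ?thesis
    proof (rule interiorI)
      show "open ({real_of_int i - 1<..<real_of_int i + 1} \<times> {real_of_int (hi' i)<..<real_of_int (lo i)})"
        by (intro open_Times) auto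
      show "(real_of_int i, y) \<in> {real_of_int i - 1<..<real_of_int i + 1} \<times> {real_of_int (hi' i)<..<real_of_int (lo i)}"
        using between by auto
      show "{real_of_int i - 1<..<real_of_int i + 1} \<times> {real_of_int (hi' i)<..<real_of_int (lo i)} \<subseteq> R"
      proof
        fix p assume p: "p \<in> {real_of_int i - 1<..<real_of_int i + 1} \<times> {real_of_int (hi' i)<..<real_of_int (lo i)}"
        define k where "k = (if fst p < i then i - 1 else i)"
        have "real_of_int (h' k) \<le> real_of_int (hi' i)" "real_of_int (lo i) \<le> real_of_int (h k)"
          using bounds by (auto simp: k_def)
        then have "p \<in> {real_of_int k..real_of_int (k + 1)} \<times> {real_of_int (h' k)..real_of_int (h k)}"
          using p by (auto simp: k_def mem_Times_iff)
        moreover have "k \<in> {0..<m}" using i \<open>i \<noteq> 0\<close> \<open>i \<noteq> m\<close> by (auto simp: k_def)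
        ultimately show "p \<in> R" unfolding R_def by blast
      qed
    qed
  qed
  have open_part: "(x, y) \<in> interior R" if xy: "(x, y) \<in> R" "(x, y) \<notin> C" for x y
  proof (cases "\<exists>i. 0 \<le> i \<and> i \<le> m \<and> x = real_of_int i \<and> real_of_int (l i) \<le> y \<and> y \<le> real_of_int (u i)")
    case True
    then obtain i where "0 \<le> i" "i \<le> m" "x = real_of_int i" "real_of_int (l i) \<le> y" "y \<le> real_of_int (u i)"
      by blast
    then show ?thesis using on_column[of i y] xy(2) by simp
  next
    case False
    then have "(x, y) \<notin> (\<Union>i\<in>{0..m}. {real_of_int i} \<times> {real_of_int (l i)..real_of_int (u i)})"
      by simp
    then have "(x, y) \<in> (\<Union>i\<in>{0..<m}. {real_of_int i..real_of_int (i + 1)} \<times> {real_of_int (h' i)..real_of_int (h i)})"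
      using xy(1) unfolding R_def by (simp only: Un_iff simp_thms)
    then obtain i where "i \<in> {0..<m}"
      "(x, y) \<in> {real_of_int i..real_of_int (i + 1)} \<times> {real_of_int (h' i)..real_of_int (h i)}"
      by (rule UN_E)
    then have i: "0 \<le> i" "i < m" and x: "real_of_int i \<le> x" "x \<le> real_of_int (i + 1)"
      and y: "real_of_int (h' i) \<le> y" "y \<le> real_of_int (h i)"
      by simp_all
    have "l j \<le> h' i \<and> h i \<le> u j" if "j = i \<or> j = i + 1" for j
      using hP[OF i] hQ[OF i] that by (auto simp: l_def u_def)
    then have "real_of_int (l j) \<le> real_of_int (h' i) \<and> real_of_int (h i) \<le> real_of_int (u j)"
      if "j = i \<or> j = i + 1" for j
      using that by (simp only: of_int_le_iff)
    then have hull: "real_of_int (l j) \<le> y \<and> y \<le> real_of_int (u j)" if "j = i \<or> j = i + 1" for j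
      using y that order_trans by blast
    have "x \<noteq> real_of_int i" using False hull[of i] i(1) less_imp_le[OF i(2)] by blast
    moreover have "x \<noteq> real_of_int (i + 1)"
    proof
      assume "x = real_of_int (i + 1)"
      moreover have "0 \<le> i + 1" "i + 1 \<le> m" using i by simp_all
      ultimately show False using False hull[of "i + 1"] by blast
    qed
    moreover have "y \<noteq> real_of_int (h' i)" "y \<noteq> real_of_int (h i)"
      using xy(2) C_step[OF i x] C_step'[OF i x] by metis+
    ultimately have "(x, y) \<in> {real_of_int i<..<real_of_int (i + 1)} \<times> {real_of_int (h' i)<..<real_of_int (h i)}"
      using x y by auto
    moreover have "open ({real_of_int i<..<real_of_int (i + 1)} \<times> {real_of_int (h' i)<..<real_of_int (h i)})"
      by (intro open_Times) auto
    moreover have "{real_of_int i<..<real_of_int (i + 1)} \<times> {real_of_int (h' i)<..<real_of_int (h i)} \<subseteq> R"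
    proof -
      have "{real_of_int i<..<real_of_int (i + 1)} \<times> {real_of_int (h' i)<..<real_of_int (h i)} \<subseteq>
          {real_of_int i..real_of_int (i + 1)} \<times> {real_of_int (h' i)..real_of_int (h i)}" by auto
      moreover have "i \<in> {0..<m}" using i by simp
      ultimately show ?thesis unfolding R_def by blast
    qed
    ultimately show ?thesis using interiorI by metis
  qed
  have inR: "plane_pt p \<in> C \<union> inside C" if "0 \<le> fst p" "fst p \<le> m" "l (fst p) \<le> snd p" "snd p \<le> u (fst p)" for p
  proof (cases "plane_pt p \<in> C")
    case False
    \<comment> \<open>A connected set that avoids \<open>C\<close> avoids the frontier of
      \<open>R\<close>, so the component of a point of \<open>R\<close> stays in the bounded set
      \<open>R\<close>.\<close>
    define S where "S = connected_component_set (- C) (plane_pt p)"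
    have "plane_pt p \<in> R"
      using that by (auto simp: R_def plane_pt_def)
    moreover have "plane_pt p \<in> S" using False by (simp add: S_def)
    moreover have "S \<inter> C = {}" using connected_component_subset[of "- C" "plane_pt p"] by (auto simp: S_def)
    moreover have "frontier R \<subseteq> C"
      using open_part compact_imp_closed[OF \<open>compact R\<close>] by (auto simp: frontier_def)
    moreover have "connected S" by (simp add: S_def)
    ultimately have "S \<subseteq> R"
      using connected_Int_frontier[of S R] by blast
    then have "bounded S" using compact_imp_bounded[OF \<open>compact R\<close>] bounded_subset by blast
    then show ?thesis using False by (simp add: inside_def S_def)
  qed simp
  have out: "plane_pt p \<notin> C \<union> inside C"
    if "\<not> (0 \<le> fst p \<and> fst p \<le> m \<and> l (fst p) \<le> snd p \<and> snd p \<le> u (fst p))" for p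
  proof -
    \<comment> \<open>A vertical ray from the point away from the hull: it misses \<open>C\<close>
      and is unbounded, so the point is not inside. For an abscissa outside the range either
      direction would do.\<close>
    define V where "V = {real_of_int (fst p)} \<times>
      (if snd p < l (fst p) then {..real_of_int (snd p)} else {real_of_int (snd p)..})"
    have "plane_pt p \<in> V" by (simp add: V_def plane_pt_def)
    have "V \<subseteq> - C"
    proof (rule subsetI, rule ComplI)
      fix q assume q: "q \<in> V" "q \<in> C"
      then have "q = (real_of_int (fst p), snd q)" by (auto simp: V_def)
      then have c: "real_of_int (l (fst p)) \<le> snd q \<and> snd q \<le> real_of_int (u (fst p)) \<and> 0 \<le> fst p \<and> fst p \<le> m"
        using column[of "fst p" "snd q"] q(2) by simp
      show False
      proof (cases "snd p < l (fst p)")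
        case True
        then have "snd q \<le> real_of_int (snd p)" using q(1) by (auto simp: V_def)
        then show False using c True by linarith
      next
        case False
        then have "real_of_int (snd p) \<le> snd q" using q(1) by (auto simp: V_def)
        moreover have "u (fst p) < snd p" using that c False by linarith
        ultimately show False using c by linarith
      qed
    qed
    have "connected V" unfolding V_def by (intro connected_Times) auto
    have "\<not> bounded V"
    proof
      assume "bounded V"
      then have "bounded (snd ` V)" by (rule bounded_snd)
      then obtain a where a: "\<And>y. y \<in> snd ` V \<Longrightarrow> \<bar>y\<bar> \<le> a" by (auto simp: bounded_real)
      define y where "y = (if snd p < l (fst p) then - 1 else 1) * (\<bar>real_of_int (snd p)\<bar> + \<bar>a\<bar> + 1)"
      have "(real_of_int (fst p), y) \<in> V" by (auto simp: V_def y_def)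
      then have "\<bar>y\<bar> \<le> a" using a by force
      moreover have "\<bar>y\<bar> = \<bar>real_of_int (snd p)\<bar> + \<bar>a\<bar> + 1" by (auto simp: y_def abs_mult)
      ultimately show False by linarith
    qed
    moreover have "V \<subseteq> connected_component_set (- C) (plane_pt p)"
      using \<open>plane_pt p \<in> V\<close> \<open>V \<subseteq> - C\<close> \<open>connected V\<close> by (intro connected_component_maximal)
    ultimately have "plane_pt p \<notin> inside C"
      using bounded_subset by (auto simp: inside_def)
    then show ?thesis using \<open>plane_pt p \<in> V\<close> \<open>V \<subseteq> - C\<close> by auto
  qed
  have "enclosed_region C = {p. 0 \<le> fst p \<and> fst p \<le> m \<and> l (fst p) \<le> snd p \<and> snd p \<le> u (fst p)}"
    unfolding enclosed_region_def using inR out by blast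
  moreover have "\<forall>i. 0 \<le> i \<and> i \<le> m \<longrightarrow> l i \<le> u i"
    using lohi by (auto simp: l_def u_def min_le_iff_disj le_max_iff_disj)
  ultimately show ?thesis unfolding C_def by blast
qed

section \<open>Discounted exit potentials\<close>

text \<open>The weights depend on the column alone, which encodes the invariance in
  \<open>y\<close>. Their sum is only bounded by 1, so that columns outside the region can carry the
  weights 0.\<close>

locale column_walk =
  fixes m :: int and wr wl wu wd :: "int \<Rightarrow> real"
  assumes weight_nonneg: "wr i \<ge> 0" "wl i \<ge> 0" "wu i \<ge> 0" "wd i \<ge> 0"
    and weight_sum: "wr i + wl i + wu i + wd i \<le> 1"
begin

text \<open>The transition operator of the walk without killing; killing enters through functions
  that vanish outside the region.\<close>

definition avg :: "(int \<times> int \<Rightarrow> real) \<Rightarrow> int \<times> int \<Rightarrow> real" where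
  "avg u p = wr (fst p) * u (fst p + 1, snd p) + wl (fst p) * u (fst p - 1, snd p) +
     wu (fst p) * u (fst p, snd p + 1) + wd (fst p) * u (fst p, snd p - 1)"

text \<open>The probability that the walk from \<open>p\<close>, killed outside \<open>G\<close>, first visits the column \<open>m\<close> at
  time \<open>n\<close> and does so at \<open>a\<close>, provided that \<open>a\<close> lies on that column.\<close>

primrec hit :: "(int \<times> int) set \<Rightarrow> int \<times> int \<Rightarrow> nat \<Rightarrow> int \<times> int \<Rightarrow> real" where
  "hit G a 0 = (\<lambda>p. if p = a \<and> p \<in> G then 1 else 0)"
| "hit G a (Suc n) = (\<lambda>p. if p \<in> G \<and> fst p \<noteq> m then avg (hit G a n) p else 0)"

text \<open>The generating function of the exit time at \<open>a\<close>. For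
  \<open>0 \<le> z < 1\<close> the series converges and the maximum principle holds on every finite
  set, even where the undiscounted walk is trapped forever.\<close>

definition potential :: "real \<Rightarrow> (int \<times> int) set \<Rightarrow> int \<times> int \<Rightarrow> int \<times> int \<Rightarrow> real" where
  "potential z G a p = (\<Sum>n. hit G a n p * z ^ n)"

text \<open>Vanishing outside \<open>G\<close> models the killing. The exit column carries no
  equation: its values are boundary data.\<close>

definition discounted_harmonic :: "real \<Rightarrow> (int \<times> int) set \<Rightarrow> (int \<times> int \<Rightarrow> real) \<Rightarrow> bool" where
  "discounted_harmonic z G u \<longleftrightarrow>
     (\<forall>p. p \<notin> G \<longrightarrow> u p = 0) \<and> (\<forall>p\<in>G. fst p \<noteq> m \<longrightarrow> u p = z * avg u p)"

lemma discounted_harmonic_outside: "discounted_harmonic z G u \<Longrightarrow> p \<notin> G \<Longrightarrow> u p = 0"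
  unfolding discounted_harmonic_def by blast

lemma avg_mono:
  assumes "\<And>q. lattice_adj p q \<Longrightarrow> u q \<le> v q"
  shows "avg u p \<le> avg v p"
  unfolding avg_def
  by (intro add_mono mult_left_mono weight_nonneg assms) (auto simp: lattice_adj_def)

lemma avg_const_le: "0 \<le> c \<Longrightarrow> avg (\<lambda>_. c) p \<le> c"
  using mult_right_mono[OF weight_sum[of "fst p"], of c] by (simp add: avg_def algebra_simps)

lemma avg_linear: "avg (\<lambda>p. c * u p + d * v p) p = c * avg u p + d * avg v p"
  by (simp add: avg_def algebra_simps)

lemma avg_nonneg: "(\<And>q. 0 \<le> u q) \<Longrightarrow> 0 \<le> avg u p"
  unfolding avg_def by (intro add_nonneg_nonneg mult_nonneg_nonneg weight_nonneg) auto

lemma hit_bounds: "0 \<le> hit G a n p \<and> hit G a n p \<le> 1"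
proof (induction n arbitrary: p)
  case (Suc n)
  have "avg (hit G a n) p \<le> avg (\<lambda>_. 1) p" using Suc by (intro avg_mono) blast
  also have "\<dots> \<le> 1" by (rule avg_const_le) simp
  finally show ?case using Suc by (auto intro: avg_nonneg)
qed auto

lemma hit_outside: "p \<notin> G \<Longrightarrow> hit G a n p = 0"
  by (cases n) auto

lemma summable_hit:
  assumes "0 \<le> z" "z < 1"
  shows "summable (\<lambda>n. hit G a n p * z ^ n)"
proof (rule summable_comparison_test')
  show "summable (\<lambda>n. z ^ n)" using assms by (simp add: summable_geometric)
  show "norm (hit G a n p * z ^ n) \<le> z ^ n" if "n \<ge> 0" for n
    using hit_bounds[of G a n p] assms by (simp add: abs_mult mult_left_le_one_le)
qed

lemma potential_nonneg: "0 \<le> z \<Longrightarrow> z < 1 \<Longrightarrow> 0 \<le> potential z G a p"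
  unfolding potential_def by (intro suminf_nonneg summable_hit) (auto simp: hit_bounds)

text \<open>First-step analysis, term by term in the series. Since \<open>a\<close> lies on the exit
  column, the term at time 0 vanishes off that column.\<close>

lemma potential_harmonic:
  assumes "0 \<le> z" "z < 1" "fst a = m"
  shows "discounted_harmonic z G (potential z G a)"
  unfolding discounted_harmonic_def
proof (intro conjI allI ballI impI)
  fix p assume "p \<notin> G"
  then show "potential z G a p = 0" by (simp add: potential_def hit_outside)
next
  fix p assume p: "p \<in> G" "fst p \<noteq> m"
  have sums: "(\<lambda>n. hit G a n q * z ^ n) sums potential z G a q" for q
    unfolding potential_def using summable_hit[OF assms(1,2)] by (rule summable_sums)
  have "(\<lambda>n. z * (wr (fst p) * (hit G a n (fst p + 1, snd p) * z ^ n) +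
      wl (fst p) * (hit G a n (fst p - 1, snd p) * z ^ n) +
      wu (fst p) * (hit G a n (fst p, snd p + 1) * z ^ n) +
      wd (fst p) * (hit G a n (fst p, snd p - 1) * z ^ n))) sums (z * avg (potential z G a) p)"
    unfolding avg_def by (intro sums_add sums_mult sums)
  also have "(\<lambda>n. z * (wr (fst p) * (hit G a n (fst p + 1, snd p) * z ^ n) +
      wl (fst p) * (hit G a n (fst p - 1, snd p) * z ^ n) +
      wu (fst p) * (hit G a n (fst p, snd p + 1) * z ^ n) +
      wd (fst p) * (hit G a n (fst p, snd p - 1) * z ^ n))) = (\<lambda>n. hit G a (Suc n) p * z ^ Suc n)"
    using p by (simp add: avg_def algebra_simps)
  finally have "(\<lambda>n. hit G a n p * z ^ n) sums (z * avg (potential z G a) p + hit G a 0 p * z ^ 0)"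
    by (rule sums_Suc)
  moreover have "hit G a 0 p = 0" using p assms(3) by auto
  ultimately show "potential z G a p = z * avg (potential z G a) p"
    using sums[of p] sums_unique2 by fastforce
qed

lemma potential_exit_column:
  assumes "p \<in> G" "fst p = m"
  shows "potential z G a p = (if p = a then 1 else 0)"
proof -
  have "hit G a n p * z ^ n = (if n = 0 then if p = a then 1 else 0 else 0)" for n
    using assms by (cases n) auto
  then have "potential z G a p = (\<Sum>n. if n = 0 then if p = a then 1 else 0 else 0)"
    by (simp add: potential_def)
  then show ?thesis using suminf_finite[of "{0::nat}" "\<lambda>n. if n = 0 then if p = a then 1 else 0 else 0 :: real"]
    by auto
qed

text \<open>Where \<open>v\<close> attains a positive maximum \<open>c\<close>, the hypothesis would
  give \<open>c \<le> z * avg v q \<le> z * c < c\<close>. The second inequality holds because the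
  weights sum to at most 1 and \<open>v \<le> c\<close> is true off \<open>S\<close> as
  well.\<close>

lemma maximum_principle:
  assumes "finite S" "0 \<le> z" "z < 1"
    and super: "\<And>p. p \<in> S \<Longrightarrow> v p \<le> 0 \<or> v p \<le> z * avg v p"
    and "\<And>p. p \<notin> S \<Longrightarrow> v p \<le> 0"
  shows "v p \<le> 0"
proof (rule ccontr)
  assume "\<not> v p \<le> 0"
  then have "p \<in> S" using assms by blast
  define c where "c = Max (v ` S)"
  have vc: "v q \<le> c" if "q \<in> S" for q using that assms(1) by (simp add: c_def)
  have "0 < c" using vc[OF \<open>p \<in> S\<close>] \<open>\<not> v p \<le> 0\<close> by linarith
  then have vc': "v q \<le> c" for q using vc assms(5)[of q] by (cases "q \<in> S") auto
  have "c \<in> v ` S" unfolding c_def using assms(1) \<open>p \<in> S\<close> by (intro Max_in) auto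
  then obtain q where q: "q \<in> S" "v q = c" by auto
  have "avg v q \<le> avg (\<lambda>_. c) q" using vc' by (intro avg_mono)
  also have "\<dots> \<le> c" using \<open>0 < c\<close> by (intro avg_const_le) simp
  finally have "z * avg v q \<le> z * c" using \<open>0 \<le> z\<close> by (rule mult_left_mono)
  also have "\<dots> < c" using \<open>z < 1\<close> \<open>0 < c\<close> by simp
  finally show False using super[OF q(1)] q(2) \<open>0 < c\<close> by simp
qed

text \<open>Let \<open>S\<close> be the part of \<open>{u > 0}\<close> linked to \<open>t\<close>,
  and truncate \<open>u\<close> to 0 outside \<open>S\<close>. If \<open>a\<close> were missing from
  \<open>S\<close>, then \<open>S\<close> would not meet the exit column, the truncation would be
  subharmonic on \<open>S\<close>, and the maximum principle would contradict
  \<open>u t > 0\<close>.\<close>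

lemma positive_set_reaches:
  assumes "finite G" "0 \<le> z" "z < 1" "discounted_harmonic z G u"
    and exit: "\<And>p. p \<in> G \<Longrightarrow> fst p = m \<Longrightarrow> p \<noteq> a \<Longrightarrow> u p \<le> 0"
    and "u t > 0"
  shows "linked {p \<in> G. u p > 0} t a"
proof (rule ccontr)
  assume not_linked: "\<not> ?thesis"
  define S where "S = {p. linked {p \<in> G. u p > 0} t p}"
  define v where "v p = (if p \<in> S then u p else 0)" for p
  have SG: "p \<in> G \<and> u p > 0" if "p \<in> S" for p using that linked_in[of "{p \<in> G. u p > 0}" t p] by (simp add: S_def)
  have "t \<in> G" using discounted_harmonic_outside[OF assms(4), of t] assms(6) by force
  then have "t \<in> S" using assms(6) by (simp add: S_def linked_refl)
  have "v t \<le> 0"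
  proof (rule maximum_principle[where S = S and z = z])
    show "finite S" using SG finite_subset[OF _ assms(1)] by blast
    fix p assume p: "p \<in> S"
    have "p \<noteq> a" using p not_linked by (auto simp: S_def)
    then have "fst p \<noteq> m" using exit[of p] SG[OF p] by auto
    then have "u p = z * avg u p" using assms(4) SG[OF p] by (auto simp: discounted_harmonic_def)
    \<comment> \<open>Truncation lowers no neighbour: one with \<open>u > 0\<close> belongs to
      \<open>S\<close>, and at the others \<open>u \<le> 0\<close>.\<close>
    moreover have "avg u p \<le> avg v p"
    proof (rule avg_mono)
      fix q assume "lattice_adj p q"
      show "u q \<le> v q"
      proof (cases "u q > 0")
        case True
        then have "q \<in> G" using discounted_harmonic_outside[OF assms(4), of q] by force
        then have "q \<in> S" using linked_step[of _ t p q] True p \<open>lattice_adj p q\<close> by (simp add: S_def)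
        then show ?thesis by (simp add: v_def)
      qed (auto simp: v_def dest: SG)
    qed
    ultimately show "v p \<le> 0 \<or> v p \<le> z * avg v p" using p \<open>0 \<le> z\<close> by (simp add: v_def mult_left_mono)
  qed (use assms in \<open>auto simp: v_def\<close>)
  then show False using \<open>t \<in> S\<close> \<open>u t > 0\<close> by (simp add: v_def)
qed

text \<open>Otherwise \<open>v\<close> is nonpositive at \<open>x\<close> and at all points of
  \<open>W\<close> next to \<open>G - W\<close>. Being zero off \<open>W\<close>, it is then
  superharmonic on all of \<open>G\<close> off the exit column, so \<open>u - v\<close> is
  subharmonic with exit values zero, and the maximum principle gives \<open>u x \<le> v x\<close>, a
  contradiction.\<close>

lemma positive_in_subregion:
  assumes "finite G" "0 \<le> z" "z < 1" "W \<subseteq> G"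
    and u: "discounted_harmonic z G u" and v: "discounted_harmonic z W v"
    and exit: "\<And>p. p \<in> G \<Longrightarrow> fst p = m \<Longrightarrow> u p = v p"
    and "u x > 0"
  shows "\<exists>t\<in>W. v t > 0 \<and> (t = x \<or> (\<exists>p\<in>G - W. lattice_adj p t))"
proof (rule ccontr)
  assume none: "\<not> ?thesis"
  have v0: "p \<notin> W \<Longrightarrow> v p = 0" for p using discounted_harmonic_outside[OF v] .
  define w where "w p = 1 * u p + (-1) * v p" for p
  have "w x \<le> 0"
  proof (rule maximum_principle[where S = G and z = z])
    fix p assume p: "p \<in> G"
    show "w p \<le> 0 \<or> w p \<le> z * avg w p"
    proof (cases "fst p = m")
      case True
      then show ?thesis using exit p by (simp add: w_def)
    next
      case False
      have "v p \<ge> z * avg v p"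
      proof (cases "p \<in> W")
        case True
        then show ?thesis using v False by (simp add: discounted_harmonic_def)
      next
        case out: False
        have "avg v p \<le> avg (\<lambda>_. 0) p"
        proof (rule avg_mono)
          fix q assume "lattice_adj p q"
          then show "v q \<le> 0" using none out p v0[of q] by force
        qed
        then have "avg v p \<le> 0" by (simp add: avg_def)
        then show ?thesis using v0[OF out] \<open>0 \<le> z\<close> by (simp add: mult_nonneg_nonpos)
      qed
      moreover have "u p = z * avg u p" using u False p by (simp add: discounted_harmonic_def)
      ultimately show ?thesis
        unfolding w_def avg_linear by (simp add: algebra_simps)
    qed
  next
    fix p assume "p \<notin> G"
    then have "u p = 0" "v p = 0"
      using discounted_harmonic_outside[OF u] v0 \<open>W \<subseteq> G\<close> by blast+
    then show "w p \<le> 0" by (simp add: w_def)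
  qed (use assms in auto)
  then have "v x > 0" using \<open>u x > 0\<close> by (simp add: w_def)
  then show False using none v0[of x] by fastforce
qed

section \<open>Vertical shift and log-concavity of the discounted potentials\<close>

definition shift_up :: "(int \<times> int) set \<Rightarrow> (int \<times> int) set" where
  "shift_up G = {p. (fst p, snd p - 1) \<in> G}"

text \<open>The weights depend on the column alone, so a vertical translation of region, start and
  target preserves the weight of every walk.\<close>

lemma hit_shift_up:
  "hit (shift_up G) a n p = hit G (fst a, snd a - 1) n (fst p, snd p - 1)"
  by (induction n arbitrary: p) (auto simp: shift_up_def avg_def prod_eq_iff)

lemma potential_shift_up:
  "potential z (shift_up G) a p = potential z G (fst a, snd a - 1) (fst p, snd p - 1)"
  by (simp add: potential_def hit_shift_up)

lemma potential_log_concave: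
  fixes l h :: "int \<Rightarrow> int"
  assumes z: "0 \<le> z" "z < 1" and "0 < m"
    and G: "G = {p. 0 \<le> fst p \<and> fst p \<le> m \<and> l (fst p) \<le> snd p \<and> snd p \<le> h (fst p)}"
    and lh: "\<And>i. 0 \<le> i \<Longrightarrow> i \<le> m \<Longrightarrow> l i \<le> h i"
    and O: "(0, 0) \<in> G" and k: "(m, k - 1) \<in> G" "(m, k + 1) \<in> G"
  shows "potential z G (m, k - 1) (0, 0) * potential z G (m, k + 1) (0, 0)
    \<le> (potential z G (m, k) (0, 0))\<^sup>2"
proof (rule ccontr)
  assume violated: "\<not> ?thesis"
  \<comment> \<open>A common bound for the column heights. It makes the region finite, as the
    maximum principle requires, and later fixes the size of the box for the crossing
    argument.\<close>
  have "\<exists>N. \<forall>i\<in>{0..m}. \<bar>l i\<bar> \<le> N \<and> \<bar>h i\<bar> \<le> N"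
  proof -
    define N where "N = Max ((\<lambda>i. max \<bar>l i\<bar> \<bar>h i\<bar>) ` {0..m})"
    have "max \<bar>l i\<bar> \<bar>h i\<bar> \<le> N" if "i \<in> {0..m}" for i
      unfolding N_def using that by (intro Max_ge) auto
    then show ?thesis by (intro exI[of _ N]) auto
  qed
  then obtain N where N: "\<And>i. 0 \<le> i \<Longrightarrow> i \<le> m \<Longrightarrow> \<bar>l i\<bar> \<le> N \<and> \<bar>h i\<bar> \<le> N"
    by (meson atLeastAtMost_iff)
  have "p \<in> {0..m} \<times> {-N..N}" if "p \<in> G" for p
    using that N[of "fst p"] by (cases p) (auto simp: G)
  then have "G \<subseteq> {0..m} \<times> {-N..N}" by blast
  then have finG: "finite G" by (rule finite_subset) auto
  have "shift_up G = (\<lambda>p. (fst p, snd p + 1)) ` G"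
    by (force simp: shift_up_def image_iff)
  then have finG': "finite (shift_up G)" using finG by simp
  define W where "W = G \<inter> shift_up G"
  have WG: "W \<subseteq> G" "W \<subseteq> shift_up G" by (auto simp: W_def)
  have finW: "finite W" using finG by (simp add: W_def)
  define P where "P j = potential z G (m, j) (0, 0)" for j
  have P: "P j \<ge> 0" for j using z by (simp add: P_def potential_nonneg)
  have viol: "P (k - 1) * P (k + 1) > P k * P k"
    using violated by (simp add: P_def power2_eq_square)
  then have "P (k - 1) * P (k + 1) > 0" using P[of k] by (meson mult_nonneg_nonneg order_le_less_trans)
  then have pos: "P (k - 1) > 0" "P (k + 1) > 0"
    using P[of "k - 1"] P[of "k + 1"] by (auto simp: zero_less_mult_iff)
  \<comment> \<open>For \<open>P k > 0\<close> the violated inequality reads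
    \<open>P k / P (k - 1) < P (k + 1) / P k\<close>, and \<open>c\<close> is taken strictly
    between. For \<open>P k = 0\<close> every positive \<open>c\<close> works.\<close>
  obtain c where c: "c \<ge> 0" "c * P (k - 1) - P k > 0" "c * P k - P (k + 1) < 0"
  proof (cases "P k = 0")
    case True
    show ?thesis by (rule that[of 1]) (use True pos in auto)
  next
    case False
    then have "P k > 0" using P[of k] by simp
    have "P k / P (k - 1) < P (k + 1) / P k"
      using viol pos \<open>P k > 0\<close> by (simp add: field_simps)
    then obtain c where c: "P k / P (k - 1) < c" "c < P (k + 1) / P k" using dense by blast
    show ?thesis
    proof (rule that[of c])
      have "0 < P k / P (k - 1)" using pos \<open>P k > 0\<close> by simp
      then show "c \<ge> 0" using c by linarith
      show "c * P (k - 1) - P k > 0" "c * P k - P (k + 1) < 0"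
        using c pos \<open>P k > 0\<close> by (simp_all add: field_simps)
    qed
  qed
  define u where "u A p = c * potential z A (m, k) p + (-1) * potential z A (m, k + 1) p" for A p
  have harm: "discounted_harmonic z A (u A)" for A
    using potential_harmonic[OF z, of "(m, k)" A] potential_harmonic[OF z, of "(m, k + 1)" A]
    unfolding discounted_harmonic_def u_def avg_linear by (auto simp: algebra_simps)
  have harm': "discounted_harmonic z A (\<lambda>p. - u A p)" for A
    using harm[of A] avg_linear[of "-1" "u A" 0 "u A"] unfolding discounted_harmonic_def by auto
  have exit: "u A p = (if p = (m, k) then c else if p = (m, k + 1) then -1 else 0)"
    if "p \<in> A" "fst p = m" for A p
    using potential_exit_column[OF that] by (auto simp: u_def)
  have kW: "(m, k) \<in> W" "(m, k + 1) \<in> W"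
    using k by (auto simp: W_def shift_up_def G)
  \<comment> \<open>The exit values do not depend on the region: the two points that may carry a
    nonzero value lie in \<open>W\<close>, so points of \<open>A\<close> on the exit column but
    outside \<open>W\<close> have the value 0.\<close>
  have exit_eq: "u A p = u W p" if "p \<in> A" "fst p = m" "W \<subseteq> A" for A p
  proof (cases "p \<in> W")
    case True
    then show ?thesis using exit that by simp
  next
    case False
    then have "u A p = 0" using exit[OF that(1,2)] kW by auto
    moreover have "u W p = 0" using discounted_harmonic_outside[OF harm False] .
    ultimately show ?thesis by simp
  qed
  \<comment> \<open>Shifting back turns the targets \<open>(m, k)\<close> and
    \<open>(m, k + 1)\<close> into \<open>(m, k - 1)\<close> and \<open>(m, k)\<close> and the start
    into the origin, so the value is \<open>c * P (k - 1) - P k\<close>.\<close>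
  have "u (shift_up G) (0, 1) > 0"
    using c(2) by (simp add: u_def potential_shift_up P_def)
  then have "\<exists>t\<in>W. u W t > 0 \<and> (t = (0, 1) \<or> (\<exists>p\<in>shift_up G - W. lattice_adj p t))"
    by (intro positive_in_subregion[OF finG' z WG(2) harm harm exit_eq[OF _ _ WG(2)]])
  then obtain t where
    t: "t \<in> W" "u W t > 0" "t = (0, 1) \<or> (\<exists>p\<in>shift_up G - W. lattice_adj p t)"
    by blast
  have "- u G (0, 0) > 0"
    using c(3) by (simp add: u_def P_def)
  then have "\<exists>s\<in>W. - u W s > 0 \<and> (s = (0, 0) \<or> (\<exists>p\<in>G - W. lattice_adj p s))"
    by (intro positive_in_subregion[OF finG z WG(1) harm' harm']) (simp_all add: exit_eq[OF _ _ WG(1)])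
  then obtain s where
    s: "s \<in> W" "u W s < 0" "s = (0, 0) \<or> (\<exists>p\<in>G - W. lattice_adj p s)"
    by auto
  \<comment> \<open>On the exit column \<open>u W\<close> can be positive only at
    \<open>(m, k)\<close> and negative only at \<open>(m, k + 1)\<close>; the latter uses
    \<open>c \<ge> 0\<close>.\<close>
  have t_exit: "linked {p \<in> W. u W p > 0} t (m, k)"
    by (rule positive_set_reaches[OF finW z harm]) (use exit t in auto)
  have s_exit: "linked {p \<in> W. - u W p > 0} s (m, k + 1)"
    by (rule positive_set_reaches[OF finW z harm']) (use exit c s in auto)
  \<comment> \<open>The margin 2 keeps the row just above every column and the rows next to
    \<open>k\<close> inside the box.\<close>
  define D where "D = N + \<bar>k\<bar> + 2"
  define box where "box = {-1..m + 1} \<times> {-D..D}"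
  \<comment> \<open>\<open>E\<close> joins the positive set to everything above the columns,
    \<open>F\<close> the negative set to everything at or below their lowest points. Two extra
    columns are split between them: on the left at the starts, with \<open>E\<close> on top, and on
    the right at the targets, with \<open>E\<close> at the bottom. This reversal forces a crossing
    although \<open>E\<close> and \<open>F\<close> are disjoint.\<close>
  define E where "E = box \<inter> ({p \<in> W. u W p > 0} \<union>
    {p. 0 \<le> fst p \<and> fst p \<le> m \<and> snd p > h (fst p)} \<union>
    {p. fst p = -1 \<and> snd p \<ge> 1} \<union> {p. fst p = m + 1 \<and> snd p \<le> k})"
  define F where "F = box \<inter> ({p \<in> W. - u W p > 0} \<union>
    {p. 0 \<le> fst p \<and> fst p \<le> m \<and> snd p \<le> l (fst p)} \<union>
    {p. fst p = -1 \<and> snd p \<le> 0} \<union> {p. fst p = m + 1 \<and> snd p \<ge> k + 1})"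
  \<comment> \<open>Intersecting with the shift removes exactly the lowest point of each column of
    \<open>G\<close>.\<close>
  have W_iff: "p \<in> W \<longleftrightarrow> 0 \<le> fst p \<and> fst p \<le> m \<and> l (fst p) < snd p \<and> snd p \<le> h (fst p)" for p
    by (auto simp: W_def shift_up_def G)
  have W_box: "W \<subseteq> box"
  proof
    fix p assume "p \<in> W"
    then show "p \<in> box" using N[of "fst p"] by (cases p) (auto simp: W_iff box_def D_def)
  qed
  have kD: "\<bar>k\<bar> + 2 \<le> D" "1 \<le> D" using N[of 0] \<open>0 < m\<close> by (auto simp: D_def)
  have lhD: "\<bar>l i\<bar> + 2 \<le> D" "\<bar>h i\<bar> + 2 \<le> D" if "0 \<le> i" "i \<le> m" for i
    using N[OF that] by (auto simp: D_def)
  have "False" if "p \<in> E" "p \<in> F" for p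
    using that lh[of "fst p"] \<open>0 < m\<close> unfolding E_def F_def by (auto simp: W_iff)
  then have "E \<inter> F = {}" by blast
  moreover have "E \<inter> F \<noteq> {}"
  proof -
    have E_top: "\<exists>e. linked E t (e, D)"
      using t(3)
    proof
      assume t01: "t = (0, 1)"
      have "linked E t (-1, 1)"
        using t W_box \<open>0 < m\<close> kD by (intro linked_step[OF linked_refl]) (auto simp: E_def box_def t01 lattice_adj_def)
      moreover have "linked E (-1, 1) (-1, D)"
        using kD \<open>0 < m\<close> by (intro linked_vertical) (auto simp: E_def box_def)
      ultimately show ?thesis using linked_trans by blast
    next
      assume "\<exists>p\<in>shift_up G - W. lattice_adj p t"
      then obtain p where p: "p \<in> shift_up G" "p \<notin> W" "lattice_adj p t" by blast
      \<comment> \<open>A point of the shifted region outside \<open>W\<close> is the one just above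
        the top of its column in \<open>G\<close>, so from there the walk rises within
        \<open>E\<close> to the top row.\<close>
      have p': "0 \<le> fst p" "fst p \<le> m" "snd p = h (fst p) + 1"
        using p(1,2) by (auto simp: W_iff shift_up_def G)
      have up: "(fst p, y) \<in> E" if "snd p \<le> y" "y \<le> D" for y
        using that p' lhD[OF p'(1,2)] by (auto simp: E_def box_def)
      have "linked E (fst p, snd p) (fst p, D)"
        by (rule linked_vertical) (use up p' lhD[OF p'(1,2)] in auto)
      then have pD: "linked E p (fst p, D)" by simp
      have "linked E t p"
      proof (rule linked_step[OF linked_refl])
        show "t \<in> E" using t W_box by (auto simp: E_def)
        show "lattice_adj t p" using p(3) by (rule lattice_adj_sym)
        show "p \<in> E" using linked_in[OF pD] ..
      qed
      then show ?thesis using pD linked_trans by blast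
    qed
    then obtain e where e: "linked E t (e, D)" by blast
    have "linked E t (m, k)"
      using t_exit by (rule linked_mono) (use W_box in \<open>auto simp: E_def\<close>)
    moreover have "linked E (m, k) (m + 1, k)"
      using linked_in[OF calculation] \<open>0 < m\<close> kD
      by (intro linked_step[OF linked_refl]) (auto simp: E_def box_def lattice_adj_def)
    moreover have "linked E (m + 1, - D) (m + 1, k)"
      using kD \<open>0 < m\<close> by (intro linked_vertical) (auto simp: E_def box_def)
    ultimately have E: "linked E (m + 1, - D) (e, D)"
      using e linked_sym linked_trans by meson
    have F_left: "\<exists>f. linked F (-1, f) s"
      using s(3)
    proof
      assume s0: "s = (0, 0)"
      have "linked F s (-1, 0)"
        using s W_box \<open>0 < m\<close> kD by (intro linked_step[OF linked_refl]) (auto simp: F_def box_def s0 lattice_adj_def)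
      then show ?thesis using linked_sym by blast
    next
      assume "\<exists>p\<in>G - W. lattice_adj p s"
      then obtain p where p: "p \<in> G" "p \<notin> W" "lattice_adj p s" by blast
      \<comment> \<open>A point of \<open>G\<close> outside \<open>W\<close> is the lowest of its
        column. A walk in \<open>F\<close> connects it downwards to the bottom row and along that
        row to the left edge.\<close>
      have p': "0 \<le> fst p" "fst p \<le> m" "snd p = l (fst p)"
        using p(1,2) by (auto simp: W_iff G)
      have down: "(fst p, y) \<in> F" if "y \<le> snd p" "-D \<le> y" for y
        using that p' lhD[OF p'(1,2)] by (auto simp: F_def box_def)
      have "linked F (fst p, -D) (fst p, snd p)"
        by (rule linked_vertical) (use down p' lhD[OF p'(1,2)] in auto)
      then have pD: "linked F (fst p, -D) p" by simp
      have "linked F p s"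
      proof (rule linked_step[OF linked_refl])
        show "s \<in> F" using s W_box by (auto simp: F_def)
        show "lattice_adj p s" by (rule p(3))
        show "p \<in> F" using linked_in[OF pD] ..
      qed
      moreover have "linked F (-1, -D) (fst p, -D)"
      proof (rule linked_horizontal)
        fix x assume x: "-1 \<le> x" "x \<le> fst p"
        show "(x, -D) \<in> F"
        proof (cases "x = -1")
          case True
          then show ?thesis using kD \<open>0 < m\<close> by (auto simp: F_def box_def)
        next
          case False
          then have "0 \<le> x" "x \<le> m" using x p' by auto
          then show ?thesis using lhD[of x] kD by (auto simp: F_def box_def)
        qed
      qed (use p' in auto)
      ultimately show ?thesis using pD linked_trans by meson
    qed
    then obtain f where f: "linked F (-1, f) s" by blast
    have "linked F s (m, k + 1)"
      using s_exit by (rule linked_mono) (use W_box in \<open>auto simp: F_def\<close>)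
    moreover have "linked F (m, k + 1) (m + 1, k + 1)"
      using linked_in[OF calculation] \<open>0 < m\<close> kD
      by (intro linked_step[OF linked_refl]) (auto simp: F_def box_def lattice_adj_def)
    ultimately have F: "linked F (-1, f) (m + 1, k + 1)" using f linked_trans by meson
    have "F \<inter> E \<noteq> {}"
      by (rule crossing_walks_meet[OF F E]) (auto simp: E_def F_def box_def)
    then show ?thesis by auto
  qed
  ultimately show False by blast
qed

end

section \<open>First visits of a Markov chain\<close>

text \<open>The probability that a chain started at \<open>s\<close> with transitions \<open>K\<close>, supported by the sets
  \<open>succs s\<close>, first visits \<open>B\<close> at time \<open>n\<close> and does so at \<open>a\<close>, provided that \<open>a\<close> lies in \<open>B\<close>.\<close>

primrec first_visit ::
  "('s \<Rightarrow> 's \<Rightarrow> real) \<Rightarrow> ('s \<Rightarrow> 's set) \<Rightarrow> 's set \<Rightarrow> 's \<Rightarrow> nat \<Rightarrow> 's \<Rightarrow> real" where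
  "first_visit K succs B a 0 = (\<lambda>s. if s = a then 1 else 0)"
| "first_visit K succs B a (Suc n) =
     (\<lambda>s. if s \<in> B then 0 else (\<Sum>s'\<in>succs s. K s s' * first_visit K succs B a n s'))"

text \<open>For a history of positive probability this is the definition of conditional probability.
  The transition law says nothing about null histories, but there both sides vanish.\<close>

lemma markov_chain_history_step:
  assumes "markov_chain M X s0 K"
  shows "\<P>(w in M. (\<forall>t\<le>j. X t w = g t) \<and> X (Suc j) w = s) =
    \<P>(w in M. \<forall>t\<le>j. X t w = g t) * K (g j) s"
proof -
  interpret prob_space M using assms by (simp add: markov_chain_def)
  have [measurable]: "X t \<in> measurable M (count_space UNIV)" for t
    using assms by (simp add: markov_chain_def)
  define H where "H = {w \<in> space M. \<forall>t\<le>j. X t w = g t}"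
  have sets: "H \<in> events" "{w \<in> space M. (\<forall>t\<le>j. X t w = g t) \<and> X (Suc j) w = s} \<in> events"
    unfolding H_def by measurable
  show ?thesis
  proof (cases "prob H > 0")
    case True
    then have "\<P>(w in M. X (Suc j) w = s \<bar> \<forall>t\<le>j. X t w = g t) = K (g j) s"
      using assms by (simp add: markov_chain_def H_def)
    then show ?thesis
      using True by (simp add: cond_prob_def H_def field_simps conj_commute)
  next
    case False
    then have "prob H = 0" using measure_nonneg[of M H] by linarith
    moreover have "prob {w \<in> space M. (\<forall>t\<le>j. X t w = g t) \<and> X (Suc j) w = s} \<le> prob H"
      using sets by (intro finite_measure_mono) (auto simp: H_def)
    ultimately show ?thesis using measure_nonneg[of M] by (simp add: H_def order_antisym)
  qed
qed

text \<open>Induction on \<open>n\<close> with the history \<open>g\<close> up to time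
  \<open>j\<close> generalised: the state at time \<open>j + 1\<close> is appended to the history
  and summed over. States outside \<open>succs (g j)\<close> contribute a countable union of null
  sets.\<close>

lemma markov_chain_first_visit:
  fixes s0 :: "'s :: countable"
  assumes chain: "markov_chain M X s0 K"
    and succs: "\<And>s. finite (succs s)" "\<And>s s'. s' \<notin> succs s \<Longrightarrow> K s s' = 0"
  shows "\<P>(w in M. (\<forall>t\<le>j. X t w = g t) \<and> (\<forall>t. j \<le> t \<and> t < j + n \<longrightarrow> X t w \<notin> B) \<and> X (j + n) w = a) =
    \<P>(w in M. \<forall>t\<le>j. X t w = g t) * first_visit K succs B a n (g j)"
proof (induction n arbitrary: j g)
  case 0
  interpret prob_space M using chain by (simp add: markov_chain_def)
  show ?case
  proof (cases "g j = a")
    case True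
    then have "{w \<in> space M. (\<forall>t\<le>j. X t w = g t) \<and>
        (\<forall>t. j \<le> t \<and> t < j + 0 \<longrightarrow> X t w \<notin> B) \<and> X (j + 0) w = a} = {w \<in> space M. \<forall>t\<le>j. X t w = g t}"
      by auto
    then show ?thesis using True by (simp only: first_visit.simps if_True mult_1_right simp_thms)
  next
    case False
    then have "{w \<in> space M. (\<forall>t\<le>j. X t w = g t) \<and>
        (\<forall>t. j \<le> t \<and> t < j + 0 \<longrightarrow> X t w \<notin> B) \<and> X (j + 0) w = a} = {}" by auto
    then show ?thesis
      using False by (simp only: first_visit.simps if_False mult_zero_right measure_empty)
  qed
next
  case (Suc n)
  interpret prob_space M using chain by (simp add: markov_chain_def)
  have [measurable]: "X t \<in> measurable M (count_space UNIV)" for t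
    using chain by (simp add: markov_chain_def)
  define A where "A = {w \<in> space M. (\<forall>t\<le>j. X t w = g t) \<and>
    (\<forall>t. j \<le> t \<and> t < j + Suc n \<longrightarrow> X t w \<notin> B) \<and> X (j + Suc n) w = a}"
  show ?case
  proof (cases "g j \<in> B")
    case True
    then have "A = {}" by (auto simp: A_def)
    then show ?thesis unfolding A_def[symmetric] using True by simp
  next
    case False
    have [measurable]: "A \<in> events" unfolding A_def by measurable
    define A' where "A' s = {w \<in> A. X (Suc j) w = s}" for s
    have A'_sets: "A' s \<in> events" for s unfolding A'_def by measurable
    have A': "prob (A' s) = \<P>(w in M. \<forall>t\<le>j. X t w = g t) * (K (g j) s * first_visit K succs B a n s)" for s
    proof -
      have le_iff: "t \<le> Suc j \<longleftrightarrow> t = Suc j \<or> t \<le> j" for t by auto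
      have *: "(\<forall>t\<le>Suc j. X t w = (g(Suc j := s)) t) \<longleftrightarrow> (\<forall>t\<le>j. X t w = g t) \<and> X (Suc j) w = s" for w
        unfolding le_iff by auto
      have **: "(\<forall>t. j \<le> t \<and> t < j + Suc n \<longrightarrow> X t w \<notin> B) \<longleftrightarrow>
          X j w \<notin> B \<and> (\<forall>t. Suc j \<le> t \<and> t < Suc j + n \<longrightarrow> X t w \<notin> B)" for w
        by (auto simp: Suc_le_eq) (metis le_neq_implies_less)
      have "A' s = {w \<in> space M. (\<forall>t\<le>Suc j. X t w = (g(Suc j := s)) t) \<and>
          (\<forall>t. Suc j \<le> t \<and> t < Suc j + n \<longrightarrow> X t w \<notin> B) \<and> X (Suc j + n) w = a}"
        unfolding A'_def A_def * ** using False by auto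
      then have "prob (A' s) = \<P>(w in M. \<forall>t\<le>Suc j. X t w = (g(Suc j := s)) t) * first_visit K succs B a n s"
        using Suc.IH[where j = "Suc j" and g = "g(Suc j := s)"] by simp
      also have "\<P>(w in M. \<forall>t\<le>Suc j. X t w = (g(Suc j := s)) t) = \<P>(w in M. \<forall>t\<le>j. X t w = g t) * K (g j) s"
        unfolding * by (rule markov_chain_history_step[OF chain])
      finally show ?thesis by simp
    qed
    define R where "R = (\<Union>s\<in>- succs (g j). A' s)"
    have "A = (\<Union>s\<in>succs (g j). A' s) \<union> R" by (auto simp: R_def A'_def)
    moreover have "R \<in> null_sets M"
      unfolding R_def
    proof (rule null_sets_UN')
      fix s assume "s \<in> - succs (g j)"
      then have "prob (A' s) = 0" using A' succs by simp
      then show "A' s \<in> null_sets M" using A'_sets by (simp add: null_sets_def emeasure_eq_measure)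
    qed auto
    ultimately have "prob A = prob (\<Union>s\<in>succs (g j). A' s)"
      using A'_sets succs(1) by (simp add: measure_Un_null_set sets.finite_UN)
    also have "\<dots> = (\<Sum>s\<in>succs (g j). prob (A' s))"
      using A'_sets succs by (intro finite_measure_finite_Union) (auto simp: disjoint_family_on_def A'_def)
    also have "\<dots> = \<P>(w in M. \<forall>t\<le>j. X t w = g t) * first_visit K succs B a (Suc n) (g j)"
      using False by (simp add: A' sum_distrib_left)
    finally show ?thesis by (simp only: A_def)
  qed
qed

text \<open>The events of a first visit to \<open>B\<close> at time \<open>n\<close> and at
  \<open>q\<close> are disjoint, and their union over \<open>n\<close> is the event measured by
  \<open>exit_prob\<close>.\<close>

lemma markov_chain_exit_sums:
  fixes s0 :: "(int \<times> int) option"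
  assumes chain: "markov_chain M X s0 K"
    and succs: "\<And>s. finite (succs s)" "\<And>s s'. s' \<notin> succs s \<Longrightarrow> K s s' = 0"
    and "q \<in> B"
  shows "(\<lambda>n. first_visit K succs (Some ` B) (Some q) n s0) sums exit_prob M X B q"
proof -
  interpret prob_space M using chain by (simp add: markov_chain_def)
  have [measurable]: "X t \<in> measurable M (count_space UNIV)" for t
    using chain by (simp add: markov_chain_def)
  define A where "A n = {w \<in> space M. (\<forall>t<n. X t w \<notin> Some ` B) \<and> X n w = Some q}" for n
  have A_sets: "A n \<in> events" for n unfolding A_def by measurable
  have X0: "AE w in M. X 0 w = s0" using chain by (simp add: markov_chain_def)
  then have "prob {w \<in> space M. X 0 w = s0} = 1"
    by (subst prob_Collect_eq_1) auto
  have "prob (A n) = first_visit K succs (Some ` B) (Some q) n s0" for n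
  proof -
    \<comment> \<open>The initial state is \<open>s0\<close> almost surely, so the history
      consisting of \<open>s0\<close> alone can be inserted.\<close>
    have "prob (A n) = \<P>(w in M. (\<forall>t\<le>0. X t w = s0) \<and>
        (\<forall>t. 0 \<le> t \<and> t < 0 + n \<longrightarrow> X t w \<notin> Some ` B) \<and> X (0 + n) w = Some q)"
      using X0 by (intro finite_measure_eq_AE) (auto simp: A_def)
    also have "\<dots> = \<P>(w in M. \<forall>t\<le>0. X t w = s0) * first_visit K succs (Some ` B) (Some q) n s0"
      by (rule markov_chain_first_visit[OF chain succs])
    finally show ?thesis using \<open>prob {w \<in> space M. X 0 w = s0} = 1\<close> by simp
  qed
  moreover have "disjoint_family A"
    unfolding disjoint_family_on_def
  proof (intro ballI impI)
    fix n n' :: nat assume "n \<noteq> n'"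
    then have "n < n' \<or> n' < n" by auto
    then show "A n \<inter> A n' = {}" using \<open>q \<in> B\<close> by (auto simp: A_def)
  qed
  then have "(\<lambda>n. prob (A n)) sums prob (\<Union>n. A n)"
    using A_sets by (intro finite_measure_UNION) auto
  moreover have "(\<Union>n. A n) = {w \<in> space M. (\<exists>t. X t w \<in> Some ` B) \<and>
      X (LEAST t. X t w \<in> Some ` B) w = Some q}"
  proof (intro set_eqI iffI)
    fix w assume "w \<in> (\<Union>n. A n)"
    then obtain n where n: "w \<in> space M" "\<forall>t<n. X t w \<notin> Some ` B" "X n w = Some q"
      by (auto simp: A_def)
    then have "(LEAST t. X t w \<in> Some ` B) = n"
      using \<open>q \<in> B\<close> by (intro Least_equality) (auto simp: not_less[symmetric])
    then show "w \<in> {w \<in> space M. (\<exists>t. X t w \<in> Some ` B) \<and>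
      X (LEAST t. X t w \<in> Some ` B) w = Some q}" using n \<open>q \<in> B\<close> by auto
  next
    fix w assume "w \<in> {w \<in> space M. (\<exists>t. X t w \<in> Some ` B) \<and>
      X (LEAST t. X t w \<in> Some ` B) w = Some q}"
    then have "w \<in> A (LEAST t. X t w \<in> Some ` B)"
      by (auto simp: A_def dest: not_less_Least)
    then show "w \<in> (\<Union>n. A n)" by blast
  qed
  ultimately show ?thesis by (simp add: exit_prob_def)
qed

section \<open>Log-concavity of the exit distribution\<close>

context column_walk
begin

text \<open>The discounts tend to 1 and each term is dominated by the undiscounted one, whose series
  converges, so Tannery's theorem permits the limit inside the sum.\<close>

lemma potential_tendsto_sum:
  assumes "(\<lambda>n. hit G a n p) sums e"
  shows "(\<lambda>j. potential (1 - inverse (real (Suc j))) G a p) \<longlonglongrightarrow> e"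
proof -
  define z where "z j = 1 - inverse (real (Suc j))" for j
  have z: "0 \<le> z j" "z j \<le> 1" for j by (simp_all add: z_def field_simps)
  have "z \<longlonglongrightarrow> 1 - 0"
    unfolding z_def by (intro tendsto_diff tendsto_const LIMSEQ_inverse_real_of_nat)
  then have "(\<lambda>j. hit G a k p * z j ^ k) \<longlonglongrightarrow> hit G a k p * (1 - 0) ^ k" for k
    by (intro tendsto_intros)
  moreover have "norm (hit G a k p * z j ^ k) \<le> hit G a k p" for k j
    using hit_bounds[of G a k p] power_le_one[OF z] z(1)[of j]
    by (simp add: abs_mult mult_left_le)
  ultimately have "(\<lambda>j. \<Sum>k. hit G a k p * z j ^ k) \<longlonglongrightarrow> (\<Sum>k. hit G a k p * (1 - 0) ^ k)"
    using sums_summable[OF assms]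
    by (intro tannerys_theorem[THEN conjunct2, THEN conjunct2]) (auto intro: always_eventually)
  then show ?thesis using sums_unique[OF assms] by (simp add: potential_def z_def)
qed

lemma exit_sum_log_concave:
  fixes l h :: "int \<Rightarrow> int"
  assumes "0 < m"
    and "G = {p. 0 \<le> fst p \<and> fst p \<le> m \<and> l (fst p) \<le> snd p \<and> snd p \<le> h (fst p)}"
    and "\<And>i. 0 \<le> i \<Longrightarrow> i \<le> m \<Longrightarrow> l i \<le> h i"
    and "(0, 0) \<in> G" "(m, k - 1) \<in> G" "(m, k + 1) \<in> G"
    and e: "\<And>j. (m, j) \<in> G \<Longrightarrow> (\<lambda>n. hit G (m, j) n (0, 0)) sums e j"
  shows "e (k - 1) * e (k + 1) \<le> (e k)\<^sup>2"
proof -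
  define P where "P i j = potential (1 - inverse (real (Suc i))) G (m, j) (0, 0)" for i j
  have "P i (k - 1) * P i (k + 1) \<le> (P i k)\<^sup>2" for i
    unfolding P_def
    by (rule potential_log_concave[where l = l and h = h]) (use assms in \<open>simp_all add: field_simps\<close>)
  moreover have "(m, k) \<in> G" using assms(2,5,6) by auto
  then have "(\<lambda>i. (P i k)\<^sup>2) \<longlonglongrightarrow> (e k)\<^sup>2"
    unfolding P_def by (intro tendsto_power potential_tendsto_sum e)
  moreover have "(\<lambda>i. P i (k - 1) * P i (k + 1)) \<longlonglongrightarrow> e (k - 1) * e (k + 1)"
    unfolding P_def by (intro tendsto_mult potential_tendsto_sum e assms)
  ultimately show ?thesis by (intro LIMSEQ_le) auto
qed

text \<open>The dead state \<open>None\<close> is absorbing and never reaches \<open>Some a\<close>,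
  and \<open>hit\<close> vanishes outside \<open>G\<close>. So the sum over the successors in the
  killed chain reduces to the weighted sum over the four neighbours.\<close>

lemma hit_eq_first_visit:
  assumes weights: "\<And>p. p \<in> G \<Longrightarrow> pip p = wr (fst p) \<and> pim p = wl (fst p) \<and> omp p = wu (fst p) \<and> omm p = wd (fst p)"
    and B: "B = {p \<in> G. fst p = m}" and "p \<in> G"
  shows "first_visit (killed_kernel G (step_prob pip pim omp omm))
      (case_option {None} (\<lambda>p. insert None (Some ` neighbours p))) (Some ` B) (Some a) n (Some p) = hit G a n p"
  using \<open>p \<in> G\<close>
proof (induction n arbitrary: p)
  case 0
  then show ?case by simp
next
  case (Suc n)
  define f where "f = first_visit (killed_kernel G (step_prob pip pim omp omm))
      (case_option {None} (\<lambda>p. insert None (Some ` neighbours p))) (Some ` B) (Some a) n"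
  have "f None = 0" unfolding f_def by (induction n) auto
  have IH: "f (Some q) = hit G a n q" if "q \<in> G" for q using Suc.IH[OF that] by (simp add: f_def)
  show ?case
  proof (cases "fst p = m")
    case True
    then show ?thesis using Suc.prems by (simp add: B)
  next
    case False
    have fin: "finite (neighbours p)" by (simp add: neighbours_def)
    have "(\<Sum>s\<in>insert None (Some ` neighbours p). killed_kernel G (step_prob pip pim omp omm) (Some p) s * f s) =
      (\<Sum>q\<in>neighbours p. (if q \<in> G then step_prob pip pim omp omm p q else 0) * f (Some q))"
      using fin \<open>f None = 0\<close> by (subst sum.insert) (auto simp: sum.reindex)
    also have "\<dots> = (\<Sum>q\<in>neighbours p. step_prob pip pim omp omm p q * hit G a n q)"
      by (intro sum.cong) (auto simp: IH hit_outside)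
    also have "\<dots> = avg (hit G a n) p"
      using weights[OF Suc.prems] by (simp add: neighbours_def step_prob_def avg_def)
    finally have "(\<Sum>s\<in>insert None (Some ` neighbours p).
        killed_kernel G (step_prob pip pim omp omm) (Some p) s * f s) = avg (hit G a n) p" .
    moreover have "Some p \<notin> Some ` B" using False by (auto simp: B)
    ultimately show ?thesis using False Suc.prems by (simp add: f_def)
  qed
qed

end

theorem theorem4p1:
  fixes m a0 a1 b0 b1 :: int
    and etap etam :: "(int \<times> int) list"
    and C :: "(real \<times> real) set"
    and \<Gamma> \<alpha> \<beta> :: "(int \<times> int) set"
    and pip pim omp omm :: "int \<times> int \<Rightarrow> real"
    and M :: "'w measure"
    and X :: "nat \<Rightarrow> 'w \<Rightarrow> (int \<times> int) option"
  assumes "m > 0"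
    and "a0 \<le> a1" and "\<alpha> = vertical_interval 0 a0 a1"
    and "b0 \<le> b1" and "\<beta> = vertical_interval m b0 b1"
    and "x_monotone_path etap" and "hd etap = (0, a1)" and "last etap = (m, b1)"
    and "x_monotone_path etam" and "hd etam = (0, a0)" and "last etam = (m, b0)"
    and "weakly_above etap etam"
    and "C = boundary_curve m a0 a1 b0 b1 etap etam"
    and "\<Gamma> = enclosed_region C"
    and "simply_connected (C \<union> inside C)"
    and "{p \<in> \<Gamma>. fst p = m} = \<beta>"
    and "(0, 0) \<in> \<alpha>"
    and "\<And>p. p \<in> \<Gamma> \<Longrightarrow> pip p \<ge> 0 \<and> pim p \<ge> 0 \<and> omp p \<ge> 0 \<and> omm p \<ge> 0"
    and "\<And>p. p \<in> \<Gamma> \<Longrightarrow> pip p + pim p + omp p + omm p = 1"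
    and "\<And>i j j'. (i, j) \<in> \<Gamma> \<Longrightarrow> (i, j') \<in> \<Gamma> \<Longrightarrow>
           pip (i, j) = pip (i, j') \<and> pim (i, j) = pim (i, j') \<and>
           omp (i, j) = omp (i, j') \<and> omm (i, j) = omm (i, j')"
    and "markov_chain M X (Some (0, 0)) (killed_kernel \<Gamma> (step_prob pip pim omp omm))"
  shows "\<forall>k. (m, k + 1) \<in> \<beta> \<and> (m, k - 1) \<in> \<beta> \<longrightarrow>
           (exit_prob M X \<beta> (m, k))\<^sup>2 \<ge> exit_prob M X \<beta> (m, k + 1) * exit_prob M X \<beta> (m, k - 1)"
proof (intro allI impI)
  fix k assume k: "(m, k + 1) \<in> \<beta> \<and> (m, k - 1) \<in> \<beta>"
  obtain l u where lu: "\<And>i. 0 \<le> i \<Longrightarrow> i \<le> m \<Longrightarrow> l i \<le> u i"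
    and G: "\<Gamma> = {p. 0 \<le> fst p \<and> fst p \<le> m \<and> l (fst p) \<le> snd p \<and> snd p \<le> u (fst p)}"
    using enclosed_region_columns[OF assms(1,2,4,6-12)] assms(13,14) by blast
  \<comment> \<open>The invariance in \<open>y\<close> is assumed only inside \<Gamma>, so each
    column takes its weights from its lowest point, and columns outside the range get 0.\<close>
  define col where "col f i = (if 0 \<le> i \<and> i \<le> m then f (i, l i) else 0)"
    for f :: "int \<times> int \<Rightarrow> real" and i
  have base: "(i, l i) \<in> \<Gamma>" if "0 \<le> i" "i \<le> m" for i using lu that by (simp add: G)
  have weights: "pip p = col pip (fst p) \<and> pim p = col pim (fst p) \<and>
      omp p = col omp (fst p) \<and> omm p = col omm (fst p)" if "p \<in> \<Gamma>" for p
  proof -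
    have i: "0 \<le> fst p" "fst p \<le> m" using that by (auto simp: G)
    show ?thesis using assms(20)[of "fst p" "snd p" "l (fst p)"] base[OF i] that i by (simp add: col_def)
  qed
  interpret column_walk m "col pip" "col pim" "col omp" "col omm"
    by standard (use assms(18,19) base in \<open>auto simp: col_def\<close>)
  have O: "(0, 0) \<in> \<Gamma>"
  proof -
    have "plane_pt (0, 0) \<in> C"
      using assms(2,3,13,17) closed_segment_vertical[OF assms(2), of 0]
      by (simp add: boundary_curve_def vertical_interval_def plane_pt_def)
    then show ?thesis by (simp add: assms(14) enclosed_region_def)
  qed
  have in_beta: "(m, j) \<in> \<beta>" if "(m, j) \<in> \<Gamma>" for j using assms(16) that by auto
  define succs where
    "succs = case_option {None} (\<lambda>p :: int \<times> int. insert None (Some ` neighbours p))"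
  have "(\<lambda>n. hit \<Gamma> (m, j) n (0, 0)) sums exit_prob M X \<beta> (m, j)" if "(m, j) \<in> \<Gamma>" for j
  proof -
    have "(\<lambda>n. first_visit (killed_kernel \<Gamma> (step_prob pip pim omp omm)) succs (Some ` \<beta>) (Some (m, j)) n (Some (0, 0)))
        sums exit_prob M X \<beta> (m, j)"
    proof (rule markov_chain_exit_sums[OF assms(21) _ _ in_beta[OF that]])
      show "finite (succs s)" for s by (simp add: succs_def neighbours_def split: option.split)
      show "killed_kernel \<Gamma> (step_prob pip pim omp omm) s s' = 0" if "s' \<notin> succs s" for s s'
        using that by (cases s; cases s') (auto simp: succs_def step_prob_def neighbours_def)
    qed
    then show ?thesis
      unfolding succs_def using hit_eq_first_visit[OF weights assms(16)[symmetric] O] by simp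
  qed
  moreover have "(m, k - 1) \<in> \<Gamma>" "(m, k + 1) \<in> \<Gamma>" using k assms(16) by auto
  ultimately have "exit_prob M X \<beta> (m, k - 1) * exit_prob M X \<beta> (m, k + 1) \<le> (exit_prob M X \<beta> (m, k))\<^sup>2"
    using exit_sum_log_concave[where e = "\<lambda>j. exit_prob M X \<beta> (m, j)", OF assms(1) G lu O] by blast
  then show "(exit_prob M X \<beta> (m, k))\<^sup>2 \<ge> exit_prob M X \<beta> (m, k + 1) * exit_prob M X \<beta> (m, k - 1)"
    by (simp add: mult.commute)
qed

end
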